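(* Let $\Omega$ be a bounded $H^1$-extension domain of $\mathbb R^3$. The operator $\widetilde{\boldsymbol{\mathrm{Tr}}}_T:\boldsymbol H(\mathbf{curl},\Omega)\to\boldsymbol B'_T(\partial\Omega)$, defined for $\boldsymbol u\in\boldsymbol H(\mathbf{curl},\Omega)$ and $\boldsymbol f\in\boldsymbol B_T(\partial\Omega)$ with optimal lift $\boldsymbol w_f\in\boldsymbol K^\perp$ (that is, $\boldsymbol\pi_T\boldsymbol w_f=\boldsymbol f$) by $$\langle\widetilde{\boldsymbol{\mathrm{Tr}}}_T\boldsymbol u,\boldsymbol f\rangle_{\boldsymbol B'_T(\partial\Omega),\boldsymbol B_T(\partial\Omega)}:=b(\boldsymbol u,\boldsymbol w_f),$$ is well-defined, linear, and continuous with $$\|\widetilde{\boldsymbol{\mathrm{Tr}}}_T\boldsymbol u\|_{\boldsymbol B'_T(\partial\Omega)}\le\sqrt2\,\|\boldsymbol u\|_{\boldsymbol H(\mathbf{curl},\Omega)} .$$ Moreover, for all $\boldsymbol u\in\boldsymbol H^1(\Omega)$ and $\boldsymbol v\in\boldsymbol H^1(\Omega)$, writing $\boldsymbol{\mathrm{Tr}}_T\boldsymbol u$ for $\widetilde{\boldsymbol{\mathrm{Tr}}}_T\boldsymbol u\in\boldsymbol B_T'(\partial\Omega)$, $$b(\boldsymbol u,\boldsymbol v)=\langle\boldsymbol{\mathrm{Tr}}_T\boldsymbol u,\boldsymbol\pi_T\boldsymbol v\rangle_{\boldsymbol B'_T(\partial\Omega),\boldsymbol B_T(\partial\Omega)}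 .$$
   Context: All functions are real-valued. A bounded domain (bounded open connected set) $\Omega\subset\mathbb R^3$ is an $H^1$-extension domain if there is a bounded linear operator $E:H^1(\Omega)\to H^1(\mathbb R^3)$ with $(Eu)|_\Omega=u$ for all $u\in H^1(\Omega)$. For such $\Omega$, the trace of $u\in H^1(\Omega)$ is defined for quasi-every $x\in\partial\Omega$ (with respect to the capacity associated with $H^1(\mathbb R^3)$) by $\mathrm{Tr}\,u(x)=\lim_{r\to0^+}\frac{1}{\lambda(\Omega\cap B_r(x))}\int_{\Omega\cap B_r(x)}u(y)\,dy$, where $\lambda$ is Lebesgue measure; functions on $\partial\Omega$ are identified when they agree quasi-everywhere. The trace space is $\mathcal B(\partial\Omega):=\mathrm{Tr}(H^1(\Omega))$ with norm $\|f\|_{\mathcal B(\partial\Omega)}=\min\{\|v\|_{H^1(\Omega)} : \mathrm{Tr}\,v=f\}$. It is known that $\mathcal B(\partial\Omega)$ is a Hilbert space and that $\mathrm{Ker}\,\mathrm{Tr}=H^1_0(\Omega)$. Vector-valued versions: $\boldsymbol H^1(\Omega)=H^1(\Omega)^3$, $\boldsymbol B(\partial\Omega)=\mathcal B(\partial\Omega)^3$, $\boldsymbol{\mathrm{Tr}}$ is the componentwise trace, $\boldsymbol B'(\partial\Omega)$ the dual of $\boldsymbol B(\partial\Omega)$. Primes denote dual spaces. $\boldsymbol H(\mathbf{curl},\Omega)=\{\boldsymbol w\in L^2(\Omega)^3:\mathbf{curl}\,\boldsymbol w\in L^2(\Omega)^3\}$ with norm $(\|\boldsymbol w\|_{L^2}^2+\|\mathbf{curl}\,\boldsymbol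 w\|_{L^2}^2)^{1/2}$. Stokes form: for $\boldsymbol u\in\boldsymbol H(\mathbf{curl},\Omega)$, $\boldsymbol v\in\boldsymbol H^1(\Omega)$, $b(\boldsymbol u,\boldsymbol v)=\int_\Omega(\boldsymbol u\cdot\mathbf{curl}\,\boldsymbol v-\boldsymbol v\cdot\mathbf{curl}\,\boldsymbol u)\,dx$. Tangential trace on $\boldsymbol H^1(\Omega)$: $\boldsymbol{\mathrm{Tr}}_T\boldsymbol u\in\boldsymbol B'(\partial\Omega)$ is the (well-defined) continuous functional with $\langle\boldsymbol{\mathrm{Tr}}_T\boldsymbol u,\boldsymbol{\mathrm{Tr}}\,\boldsymbol v\rangle=b(\boldsymbol u,\boldsymbol v)$ for all $\boldsymbol v\in\boldsymbol H^1(\Omega)$. $\boldsymbol K:=\mathrm{Ker}(\boldsymbol{\mathrm{Tr}}_T)\subset\boldsymbol H^1(\Omega)$ and $\boldsymbol K^\perp$ is its orthogonal complement in $\boldsymbol H^1(\Omega)$. $\boldsymbol B_\perp(\partial\Omega):=\boldsymbol{\mathrm{Tr}}_T(\boldsymbol H^1(\Omega))$ has the quotient norm $\|\boldsymbol f\|_{\boldsymbol B_\perp}=\inf\{\|\boldsymbol v\|_{\boldsymbol H^1(\Omega)}:\boldsymbol{\mathrm{Tr}}_T\boldsymbol v=\boldsymbol f\}$; each $\boldsymbol f\in\boldsymbol B_\perp(\partial\Omega)$ has a unique lift $\boldsymbol w_f\in\boldsymbol K^\perp$ with $\boldsymbol{\mathrm{Tr}}_T\boldsymbol w_f=\boldsymbol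 f$. Tangential component trace: for $\boldsymbol u\in\boldsymbol H^1(\Omega)$, $\boldsymbol\pi_T\boldsymbol u\in\boldsymbol B'_\perp(\partial\Omega)$ is defined by $\langle\boldsymbol\pi_T\boldsymbol u,\boldsymbol f\rangle_{\boldsymbol B'_\perp,\boldsymbol B_\perp}:=-b(\boldsymbol u,\boldsymbol w_f)$ for all $\boldsymbol f\in\boldsymbol B_\perp(\partial\Omega)$. The space $\boldsymbol B_T(\partial\Omega):=\boldsymbol\pi_T(\boldsymbol H^1(\Omega))\subset\boldsymbol B'_\perp(\partial\Omega)$ has the quotient norm $\|\boldsymbol f\|_{\boldsymbol B_T}=\inf\{\|\boldsymbol v\|_{\boldsymbol H^1(\Omega)}:\boldsymbol\pi_T\boldsymbol v=\boldsymbol f\}$. Known: $\mathrm{Ker}(\boldsymbol\pi_T)=\boldsymbol K$, so each $\boldsymbol f\in\boldsymbol B_T(\partial\Omega)$ has a unique optimal lift $\boldsymbol w_f\in\boldsymbol K^\perp$ with $\boldsymbol\pi_T\boldsymbol w_f=\boldsymbol f$, and $\boldsymbol\pi_T:\boldsymbol K^\perp\to\boldsymbol B_T(\partial\Omega)$ is a bijective isometry. *)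

theory Defs
  imports "HOL-Analysis.Analysis"
begin

type_synonym R3 = "real^3"

text \<open>
  Elements of the function spaces below are represented by functions on the whole of \<open>R3\<close> of
  which only the values on \<open>\<Omega>\<close> (for Sobolev functions) or on \<open>frontier \<Omega>\<close> (for traces) matter.
  They are identified when they agree almost everywhere on \<open>\<Omega>\<close>, resp. quasi-everywhere on
  \<open>frontier \<Omega>\<close>; statements about uniqueness are up to these identifications.
\<close>

definition ae_eq :: "R3 set \<Rightarrow> (R3 \<Rightarrow> 'b) \<Rightarrow> (R3 \<Rightarrow> 'b) \<Rightarrow> bool" where
  "ae_eq \<Omega> u v \<longleftrightarrow> (AE x in lebesgue_on \<Omega>. u x = v x)"

definition L2 :: "R3 set \<Rightarrow> (R3 \<Rightarrow> 'b::euclidean_space) set" where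
  "L2 \<Omega> = {u. u \<in> borel_measurable (lebesgue_on \<Omega>) \<and>
              integrable (lebesgue_on \<Omega>) (\<lambda>x. (norm (u x))\<^sup>2)}"

definition L2_norm :: "R3 set \<Rightarrow> (R3 \<Rightarrow> 'b::euclidean_space) \<Rightarrow> real" where
  "L2_norm \<Omega> u = sqrt (\<integral>x. (norm (u x))\<^sup>2 \<partial>lebesgue_on \<Omega>)"


subsection \<open>Test functions\<close>

definition grad :: "(R3 \<Rightarrow> real) \<Rightarrow> R3 \<Rightarrow> R3" where
  "grad \<phi> x = (\<chi> i. frechet_derivative \<phi> (at x) (axis i 1))"

definition curl :: "(R3 \<Rightarrow> R3) \<Rightarrow> R3 \<Rightarrow> R3" where
  "curl \<phi> x = (let D = (\<lambda>i j. grad (\<lambda>y. \<phi> y $ j) x $ i)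
     in vector [D 2 3 - D 3 2, D 3 1 - D 1 3, D 1 2 - D 2 1])"

primrec Ck :: "nat \<Rightarrow> (R3 \<Rightarrow> real) \<Rightarrow> bool" where
  "Ck 0 \<phi> \<longleftrightarrow> continuous_on UNIV \<phi>"
| "Ck (Suc n) \<phi> \<longleftrightarrow> (\<forall>x. \<phi> differentiable (at x)) \<and> (\<forall>i. Ck n (\<lambda>x. grad \<phi> x $ i))"

definition test_function :: "R3 set \<Rightarrow> (R3 \<Rightarrow> real) \<Rightarrow> bool" where
  "test_function \<Omega> \<phi> \<longleftrightarrow>
     (\<forall>n. Ck n \<phi>) \<and> compact (closure {x. \<phi> x \<noteq> 0}) \<and> closure {x. \<phi> x \<noteq> 0} \<subseteq> \<Omega>"

definition test_field :: "R3 set \<Rightarrow> (R3 \<Rightarrow> R3) \<Rightarrow> bool" where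
  "test_field \<Omega> \<phi> \<longleftrightarrow> (\<forall>i. test_function \<Omega> (\<lambda>x. \<phi> x $ i))"


subsection \<open>Sobolev spaces\<close>

definition has_weak_grad :: "R3 set \<Rightarrow> (R3 \<Rightarrow> real) \<Rightarrow> (R3 \<Rightarrow> R3) \<Rightarrow> bool" where
  "has_weak_grad \<Omega> u G \<longleftrightarrow>
     (\<forall>\<phi>. test_function \<Omega> \<phi> \<longrightarrow>
        (\<integral>x. u x *\<^sub>R grad \<phi> x \<partial>lebesgue_on \<Omega>) = - (\<integral>x. \<phi> x *\<^sub>R G x \<partial>lebesgue_on \<Omega>))"

definition H1 :: "R3 set \<Rightarrow> (R3 \<Rightarrow> real) set" where
  "H1 \<Omega> = {u \<in> L2 \<Omega>. \<exists>G\<in>L2 \<Omega>. has_weak_grad \<Omega> u G}"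

text \<open>Weak derivatives are unique almost everywhere, so the choice is immaterial
  inside integrals; likewise for the weak curl.\<close>

definition weak_grad :: "R3 set \<Rightarrow> (R3 \<Rightarrow> real) \<Rightarrow> R3 \<Rightarrow> R3" where
  "weak_grad \<Omega> u = (SOME G. G \<in> L2 \<Omega> \<and> has_weak_grad \<Omega> u G)"

definition H1_inner :: "R3 set \<Rightarrow> (R3 \<Rightarrow> real) \<Rightarrow> (R3 \<Rightarrow> real) \<Rightarrow> real" where
  "H1_inner \<Omega> u v = (\<integral>x. u x * v x \<partial>lebesgue_on \<Omega>)
                    + (\<integral>x. weak_grad \<Omega> u x \<bullet> weak_grad \<Omega> v x \<partial>lebesgue_on \<Omega>)"

definition H1_norm :: "R3 set \<Rightarrow> (R3 \<Rightarrow> real) \<Rightarrow> real" where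
  "H1_norm \<Omega> u = sqrt (H1_inner \<Omega> u u)"

definition H1v :: "R3 set \<Rightarrow> (R3 \<Rightarrow> R3) set" where
  "H1v \<Omega> = {u. \<forall>i. (\<lambda>x. u x $ i) \<in> H1 \<Omega>}"

definition H1v_inner :: "R3 set \<Rightarrow> (R3 \<Rightarrow> R3) \<Rightarrow> (R3 \<Rightarrow> R3) \<Rightarrow> real" where
  "H1v_inner \<Omega> u v = (\<Sum>i\<in>UNIV. H1_inner \<Omega> (\<lambda>x. u x $ i) (\<lambda>x. v x $ i))"

definition H1v_norm :: "R3 set \<Rightarrow> (R3 \<Rightarrow> R3) \<Rightarrow> real" where
  "H1v_norm \<Omega> u = sqrt (H1v_inner \<Omega> u u)"

definition has_weak_curl :: "R3 set \<Rightarrow> (R3 \<Rightarrow> R3) \<Rightarrow> (R3 \<Rightarrow> R3) \<Rightarrow> bool" where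
  "has_weak_curl \<Omega> w c \<longleftrightarrow>
     (\<forall>\<phi>. test_field \<Omega> \<phi> \<longrightarrow>
        (\<integral>x. w x \<bullet> curl \<phi> x \<partial>lebesgue_on \<Omega>) = (\<integral>x. c x \<bullet> \<phi> x \<partial>lebesgue_on \<Omega>))"

definition Hcurl :: "R3 set \<Rightarrow> (R3 \<Rightarrow> R3) set" where
  "Hcurl \<Omega> = {w \<in> L2 \<Omega>. \<exists>c\<in>L2 \<Omega>. has_weak_curl \<Omega> w c}"

definition weak_curl :: "R3 set \<Rightarrow> (R3 \<Rightarrow> R3) \<Rightarrow> R3 \<Rightarrow> R3" where
  "weak_curl \<Omega> w = (SOME c. c \<in> L2 \<Omega> \<and> has_weak_curl \<Omega> w c)"

definition Hcurl_norm :: "R3 set \<Rightarrow> (R3 \<Rightarrow> R3) \<Rightarrow> real" where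
  "Hcurl_norm \<Omega> w = sqrt ((L2_norm \<Omega> w)\<^sup>2 + (L2_norm \<Omega> (weak_curl \<Omega> w))\<^sup>2)"

definition H1_extension_property :: "R3 set \<Rightarrow> bool" where
  "H1_extension_property \<Omega> \<longleftrightarrow>
     (\<exists>E :: (R3 \<Rightarrow> real) \<Rightarrow> R3 \<Rightarrow> real.
        (\<forall>u\<in>H1 \<Omega>. E u \<in> H1 UNIV \<and> ae_eq \<Omega> (E u) u) \<and>
        (\<forall>u\<in>H1 \<Omega>. \<forall>v\<in>H1 \<Omega>. \<forall>a c.
           ae_eq UNIV (E (\<lambda>x. a * u x + c * v x)) (\<lambda>x. a * E u x + c * E v x)) \<and>
        (\<exists>C. \<forall>u\<in>H1 \<Omega>. H1_norm UNIV (E u) \<le> C * H1_norm \<Omega> u))"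


subsection \<open>Capacity and traces\<close>

text \<open>The infimum is taken in \<^typ>\<open>ennreal\<close>, so it is infinite if there is no admissible \<open>u\<close>.\<close>

definition capacity :: "R3 set \<Rightarrow> ennreal" where
  "capacity A = (INF u \<in> {u \<in> H1 UNIV. \<exists>U. open U \<and> A \<subseteq> U \<and> (AE x in lebesgue_on U. 1 \<le> u x)}.
                   ennreal ((H1_norm UNIV u)\<^sup>2))"

definition qe_eq :: "R3 set \<Rightarrow> (R3 \<Rightarrow> real) \<Rightarrow> (R3 \<Rightarrow> real) \<Rightarrow> bool" where
  "qe_eq \<Omega> f g \<longleftrightarrow> capacity {x \<in> frontier \<Omega>. f x \<noteq> g x} = 0"

definition Tr :: "R3 set \<Rightarrow> (R3 \<Rightarrow> real) \<Rightarrow> R3 \<Rightarrow> real" where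
  "Tr \<Omega> u x = Lim (at_right 0)
     (\<lambda>r. (\<integral>y. u y \<partial>lebesgue_on (\<Omega> \<inter> ball x r)) / measure lebesgue (\<Omega> \<inter> ball x r))"

definition trace_space :: "R3 set \<Rightarrow> (R3 \<Rightarrow> real) set" where
  "trace_space \<Omega> = {f. \<exists>u\<in>H1 \<Omega>. qe_eq \<Omega> (Tr \<Omega> u) f}"

definition trace_norm :: "R3 set \<Rightarrow> (R3 \<Rightarrow> real) \<Rightarrow> real" where
  "trace_norm \<Omega> f = Inf {H1_norm \<Omega> v | v. v \<in> H1 \<Omega> \<and> qe_eq \<Omega> (Tr \<Omega> v) f}"

definition Trv :: "R3 set \<Rightarrow> (R3 \<Rightarrow> R3) \<Rightarrow> R3 \<Rightarrow> R3" where
  "Trv \<Omega> u x = (\<chi> i. Tr \<Omega> (\<lambda>y. u y $ i) x)"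

definition Bv :: "R3 set \<Rightarrow> (R3 \<Rightarrow> R3) set" where
  "Bv \<Omega> = {f. \<forall>i. (\<lambda>x. f x $ i) \<in> trace_space \<Omega>}"

definition qe_eqv :: "R3 set \<Rightarrow> (R3 \<Rightarrow> R3) \<Rightarrow> (R3 \<Rightarrow> R3) \<Rightarrow> bool" where
  "qe_eqv \<Omega> f g \<longleftrightarrow> (\<forall>i. qe_eq \<Omega> (\<lambda>x. f x $ i) (\<lambda>x. g x $ i))"

definition Bv_norm :: "R3 set \<Rightarrow> (R3 \<Rightarrow> R3) \<Rightarrow> real" where
  "Bv_norm \<Omega> f = sqrt (\<Sum>i\<in>UNIV. (trace_norm \<Omega> (\<lambda>x. f x $ i))\<^sup>2)"


subsection \<open>Dual spaces\<close>

text \<open>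
  The dual of a space \<open>X\<close> of functions with (semi)norm \<open>N\<close>. Functionals are normalised to vanish
  outside \<open>X\<close>, so that two elements of the dual are equal iff they agree on \<open>X\<close>. The bound forces
  a functional to take equal values at \<open>f, g \<in> X\<close> with \<open>N (f - g) = 0\<close>, i.e. to respect the
  identification of representatives.
\<close>

definition dual :: "('x \<Rightarrow> 'y::real_vector) set \<Rightarrow> (('x \<Rightarrow> 'y) \<Rightarrow> real)
    \<Rightarrow> (('x \<Rightarrow> 'y) \<Rightarrow> real) set" where
  "dual X N = {\<phi>.
     (\<forall>f\<in>X. \<forall>g\<in>X. \<forall>a c. \<phi> (\<lambda>x. a *\<^sub>R f x + c *\<^sub>R g x) = a * \<phi> f + c * \<phi> g) \<and>
     (\<exists>C. \<forall>f\<in>X. \<bar>\<phi> f\<bar> \<le> C * N f) \<and>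
     (\<forall>f. f \<notin> X \<longrightarrow> \<phi> f = 0)}"

definition dual_norm :: "('x \<Rightarrow> 'y::real_vector) set \<Rightarrow> (('x \<Rightarrow> 'y) \<Rightarrow> real)
    \<Rightarrow> (('x \<Rightarrow> 'y) \<Rightarrow> real) \<Rightarrow> real" where
  "dual_norm X N \<phi> = Sup {\<bar>\<phi> f\<bar> | f. f \<in> X \<and> N f \<le> 1}"


subsection \<open>Tangential traces\<close>

definition stokes_form :: "R3 set \<Rightarrow> (R3 \<Rightarrow> R3) \<Rightarrow> (R3 \<Rightarrow> R3) \<Rightarrow> real" where
  "stokes_form \<Omega> u v = (\<integral>x. u x \<bullet> weak_curl \<Omega> v x - v x \<bullet> weak_curl \<Omega> u x \<partial>lebesgue_on \<Omega>)"

type_synonym bdry_functional = "(R3 \<Rightarrow> R3) \<Rightarrow> real"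

text \<open>
  The tangential trace operator on \<^term>\<open>H1v \<Omega>\<close> is specified by its defining property. Elements
  of the boundary space are classes modulo equality quasi-everywhere, so the value of the functional
  at \<^term>\<open>Trv \<Omega> v\<close> is its common value at all representatives \<open>g\<close> of that class.
\<close>

definition is_tangential_trace ::
    "R3 set \<Rightarrow> ((R3 \<Rightarrow> R3) \<Rightarrow> bdry_functional) \<Rightarrow> bool" where
  "is_tangential_trace \<Omega> TrT \<longleftrightarrow>
     (\<forall>u\<in>H1v \<Omega>. TrT u \<in> dual (Bv \<Omega>) (Bv_norm \<Omega>) \<and>
        (\<forall>v\<in>H1v \<Omega>. \<forall>g. qe_eqv \<Omega> (Trv \<Omega> v) g \<longrightarrow> TrT u g = stokes_form \<Omega> u v))"

text \<open>The property determines the operator on \<^term>\<open>H1v \<Omega>\<close>.\<close>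

lemma is_tangential_trace_unique:
  assumes T: "is_tangential_trace \<Omega> T" and T': "is_tangential_trace \<Omega> T'" and u: "u \<in> H1v \<Omega>"
  shows "T u = T' u"
proof
  fix g
  show "T u g = T' u g"
  proof (cases "g \<in> Bv \<Omega>")
    case True
    then have "\<forall>i. \<exists>w\<in>H1 \<Omega>. qe_eq \<Omega> (Tr \<Omega> w) (\<lambda>x. g x $ i)"
      by (simp add: Bv_def trace_space_def)
    then obtain w where w: "\<And>i. w i \<in> H1 \<Omega>" "\<And>i. qe_eq \<Omega> (Tr \<Omega> (w i)) (\<lambda>x. g x $ i)"
      by metis
    define v :: "R3 \<Rightarrow> R3" where "v = (\<lambda>x. \<chi> i. w i x)"
    have "v \<in> H1v \<Omega>" "qe_eqv \<Omega> (Trv \<Omega> v) g"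
      using w by (simp_all add: H1v_def v_def qe_eqv_def Trv_def)
    then show ?thesis
      using T T' u unfolding is_tangential_trace_def by metis
  next
    case False
    then show ?thesis
      using T T' u by (simp add: is_tangential_trace_def dual_def)
  qed
qed

text \<open>In what follows, \<open>TrT\<close> is the tangential trace operator on \<^term>\<open>H1v \<Omega>\<close>.\<close>

definition ker_TrT :: "R3 set \<Rightarrow> ((R3 \<Rightarrow> R3) \<Rightarrow> bdry_functional) \<Rightarrow> (R3 \<Rightarrow> R3) set" where
  "ker_TrT \<Omega> TrT = {u \<in> H1v \<Omega>. TrT u = (\<lambda>_. 0)}"

definition Kperp :: "R3 set \<Rightarrow> ((R3 \<Rightarrow> R3) \<Rightarrow> bdry_functional) \<Rightarrow> (R3 \<Rightarrow> R3) set" where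
  "Kperp \<Omega> TrT = {w \<in> H1v \<Omega>. \<forall>k\<in>ker_TrT \<Omega> TrT. H1v_inner \<Omega> w k = 0}"

definition B_perp :: "R3 set \<Rightarrow> ((R3 \<Rightarrow> R3) \<Rightarrow> bdry_functional) \<Rightarrow> bdry_functional set" where
  "B_perp \<Omega> TrT = TrT ` H1v \<Omega>"

definition B_perp_norm ::
    "R3 set \<Rightarrow> ((R3 \<Rightarrow> R3) \<Rightarrow> bdry_functional) \<Rightarrow> bdry_functional \<Rightarrow> real" where
  "B_perp_norm \<Omega> TrT f = Inf {H1v_norm \<Omega> v | v. v \<in> H1v \<Omega> \<and> TrT v = f}"

text \<open>
  Lifts orthogonal to the kernel exist and are unique almost everywhere on \<open>\<Omega>\<close>, so the choices in
  \<open>lift_perp\<close> and \<open>lift_T\<close> below do not affect \<^term>\<open>stokes_form\<close>. The functional \<open>piT \<Omega> TrT u\<close>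
  lies in the dual of \<^term>\<open>B_perp \<Omega> TrT\<close> with norm \<^term>\<open>B_perp_norm \<Omega> TrT\<close>; it is extended by 0.
\<close>

definition lift_perp ::
    "R3 set \<Rightarrow> ((R3 \<Rightarrow> R3) \<Rightarrow> bdry_functional) \<Rightarrow> bdry_functional \<Rightarrow> R3 \<Rightarrow> R3" where
  "lift_perp \<Omega> TrT f = (SOME w. w \<in> Kperp \<Omega> TrT \<and> TrT w = f)"

definition piT :: "R3 set \<Rightarrow> ((R3 \<Rightarrow> R3) \<Rightarrow> bdry_functional) \<Rightarrow> (R3 \<Rightarrow> R3)
    \<Rightarrow> bdry_functional \<Rightarrow> real" where
  "piT \<Omega> TrT u = (\<lambda>f. if f \<in> B_perp \<Omega> TrT then - stokes_form \<Omega> u (lift_perp \<Omega> TrT f) else 0)"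

definition B_T :: "R3 set \<Rightarrow> ((R3 \<Rightarrow> R3) \<Rightarrow> bdry_functional) \<Rightarrow> (bdry_functional \<Rightarrow> real) set" where
  "B_T \<Omega> TrT = piT \<Omega> TrT ` H1v \<Omega>"

definition B_T_norm :: "R3 set \<Rightarrow> ((R3 \<Rightarrow> R3) \<Rightarrow> bdry_functional)
    \<Rightarrow> (bdry_functional \<Rightarrow> real) \<Rightarrow> real" where
  "B_T_norm \<Omega> TrT f = Inf {H1v_norm \<Omega> v | v. v \<in> H1v \<Omega> \<and> piT \<Omega> TrT v = f}"

definition lift_T :: "R3 set \<Rightarrow> ((R3 \<Rightarrow> R3) \<Rightarrow> bdry_functional)
    \<Rightarrow> (bdry_functional \<Rightarrow> real) \<Rightarrow> R3 \<Rightarrow> R3" where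
  "lift_T \<Omega> TrT f = (SOME w. w \<in> Kperp \<Omega> TrT \<and> piT \<Omega> TrT w = f)"

definition TrT_ext :: "R3 set \<Rightarrow> ((R3 \<Rightarrow> R3) \<Rightarrow> bdry_functional) \<Rightarrow> (R3 \<Rightarrow> R3)
    \<Rightarrow> (bdry_functional \<Rightarrow> real) \<Rightarrow> real" where
  "TrT_ext \<Omega> TrT u = (\<lambda>f. if f \<in> B_T \<Omega> TrT then stokes_form \<Omega> u (lift_T \<Omega> TrT f) else 0)"

end

theory Submission
  imports Defs
begin

text \<open>
  On the space of H1 fields the Stokes form is antisymmetric, so its left and right kernels coincide;
  this common kernel is the kernel of both tangential traces, and \<open>piT u (TrT v) = - stokes_form u v\<close>
  because the optimal lift of \<open>TrT v\<close> differs from \<open>v\<close> by an element of the kernel. The same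
  remark gives the Green formula. Optimal lifts are the components orthogonal to the kernel in H1, hence
  lifts of minimal norm. The norm bound combines the Cauchy-Schwarz inequality
  with the pointwise bound of the square of the curl by twice that of the Jacobian. Weak derivatives
  are chosen by \<open>SOME\<close>, so that all of this rests on their uniqueness, i.e. on the fundamental
  lemma of the calculus of variations.
\<close>

subsection \<open>Square integrable functions\<close>

text \<open>The obstacle is the existence of optimal lifts, that is, the splitting of H1 fields
  along the kernel. It calls for completeness, but H1 is here just a set of functions whose weak
  derivatives are chosen by \<open>SOME\<close>. The completeness used is that of L2: a field is
  paired with its Jacobian, and in the L2 space of such pairs both "the second entry is the weak
  Jacobian of the first" and "the Stokes form against \<open>h\<close> vanishes" say that the pair
  is orthogonal to fixed elements. Projecting onto the annihilator then yields a field together with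
  its Jacobian. Boundedness of \<Omega> makes the measure finite, so that an L2 Cauchy sequence is
  also L1 Cauchy and has an almost everywhere convergent subsequence. The constant sqrt 2 stems from
  comparing the \<open>Hcurl\<close> norm with the \<open>H1v\<close> norm; in the
  \<open>Hcurl\<close> norms the Stokes form has bound 1. The boundary spaces enter through two
  facts: the trace of a field represents its own class, as the empty set has capacity 0, and every
  class in \<open>Bv\<close> has an H1 lift. They turn equality of functionals \<open>TrT u\<close>
  into equality of Stokes forms on \<Omega>.\<close>

definition L2_inner :: "R3 set \<Rightarrow> (R3 \<Rightarrow> 'b::euclidean_space) \<Rightarrow> (R3 \<Rightarrow> 'b) \<Rightarrow> real" where
  "L2_inner \<Omega> u v = (\<integral>x. u x \<bullet> v x \<partial>lebesgue_on \<Omega>)"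

lemma L2_measurable [measurable_dest]: "u \<in> L2 \<Omega> \<Longrightarrow> u \<in> borel_measurable (lebesgue_on \<Omega>)"
  by (simp add: L2_def)

lemma L2_integrable_square: "u \<in> L2 \<Omega> \<Longrightarrow> integrable (lebesgue_on \<Omega>) (\<lambda>x. (norm (u x))\<^sup>2)"
  by (simp add: L2_def)

lemma L2I_bound:
  assumes "f \<in> borel_measurable (lebesgue_on \<Omega>)" "integrable (lebesgue_on \<Omega>) g"
    and "\<And>x. x \<in> \<Omega> \<Longrightarrow> (norm (f x))\<^sup>2 \<le> g x"
  shows "f \<in> L2 \<Omega>"
proof -
  have "integrable (lebesgue_on \<Omega>) (\<lambda>x. (norm (f x))\<^sup>2)"
    by (rule Bochner_Integration.integrable_bound[OF assms(2)])
       (use assms in \<open>auto intro!: AE_I2 order.trans[OF assms(3)]\<close>)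
  then show ?thesis using assms by (simp add: L2_def)
qed

lemma L2_zero: "(\<lambda>x. 0) \<in> L2 \<Omega>"
  by (simp add: L2_def)

lemma L2_lincomb:
  assumes u: "u \<in> L2 \<Omega>" and v: "v \<in> L2 \<Omega>"
  shows "(\<lambda>x. a *\<^sub>R u x + c *\<^sub>R v x) \<in> L2 \<Omega>"
proof (rule L2I_bound)
  show "(\<lambda>x. a *\<^sub>R u x + c *\<^sub>R v x) \<in> borel_measurable (lebesgue_on \<Omega>)"
    using L2_measurable[OF u] L2_measurable[OF v] by simp
  show "integrable (lebesgue_on \<Omega>) (\<lambda>x. 2 * a\<^sup>2 * (norm (u x))\<^sup>2 + 2 * c\<^sup>2 * (norm (v x))\<^sup>2)"
    using L2_integrable_square[OF u] L2_integrable_square[OF v] by simp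
  fix x
  have "norm (a *\<^sub>R u x + c *\<^sub>R v x) \<le> \<bar>a\<bar> * norm (u x) + \<bar>c\<bar> * norm (v x)"
    by (metis norm_scaleR norm_triangle_ineq)
  then have "(norm (a *\<^sub>R u x + c *\<^sub>R v x))\<^sup>2 \<le> (\<bar>a\<bar> * norm (u x) + \<bar>c\<bar> * norm (v x))\<^sup>2"
    by (simp add: power_mono)
  also have "\<dots> \<le> 2 * (\<bar>a\<bar> * norm (u x))\<^sup>2 + 2 * (\<bar>c\<bar> * norm (v x))\<^sup>2"
    using sum_squares_bound[of "\<bar>a\<bar> * norm (u x)" "\<bar>c\<bar> * norm (v x)"] by (simp add: power2_sum)
  finally show "(norm (a *\<^sub>R u x + c *\<^sub>R v x))\<^sup>2 \<le> 2 * a\<^sup>2 * (norm (u x))\<^sup>2 + 2 * c\<^sup>2 * (norm (v x))\<^sup>2"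
    by (simp add: power_mult_distrib)
qed

lemma L2_add: "u \<in> L2 \<Omega> \<Longrightarrow> v \<in> L2 \<Omega> \<Longrightarrow> (\<lambda>x. u x + v x) \<in> L2 \<Omega>"
  using L2_lincomb[of u \<Omega> v 1 1] by simp

lemma L2_diff: "u \<in> L2 \<Omega> \<Longrightarrow> v \<in> L2 \<Omega> \<Longrightarrow> (\<lambda>x. u x - v x) \<in> L2 \<Omega>"
  using L2_lincomb[of u \<Omega> v 1 "-1"] by simp

lemma L2_scale: "u \<in> L2 \<Omega> \<Longrightarrow> (\<lambda>x. a *\<^sub>R u x) \<in> L2 \<Omega>"
  using L2_lincomb[of u \<Omega> u a 0] by simp

lemma L2_sum: "finite I \<Longrightarrow> (\<And>i. i \<in> I \<Longrightarrow> u i \<in> L2 \<Omega>) \<Longrightarrow> (\<lambda>x. \<Sum>i\<in>I. u i x) \<in> L2 \<Omega>"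
  by (induction I rule: finite_induct) (auto intro: L2_add L2_zero)

text \<open>One closure property that covers coordinates, axis embeddings, the curl of a Jacobian
  matrix, its adjoint, and the two projections of a pair.\<close>

lemma L2_bounded_linear:
  assumes T: "bounded_linear T" and u: "u \<in> L2 \<Omega>"
  shows "(\<lambda>x. T (u x)) \<in> L2 \<Omega>"
proof -
  obtain K where K: "\<And>x. norm (T x) \<le> norm x * K"
    using bounded_linear.bounded[OF T] by blast
  show ?thesis
  proof (rule L2I_bound)
    have "T \<in> borel_measurable borel"
      using T by (intro borel_measurable_continuous_onI linear_continuous_on)
    then show "(\<lambda>x. T (u x)) \<in> borel_measurable (lebesgue_on \<Omega>)"
      by (rule measurable_compose[OF L2_measurable[OF u]])
    show "integrable (lebesgue_on \<Omega>) (\<lambda>x. (norm (u x))\<^sup>2 * K\<^sup>2)"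
      using L2_integrable_square[OF u] by simp
    show "(norm (T (u x)))\<^sup>2 \<le> (norm (u x))\<^sup>2 * K\<^sup>2" for x
      using power_mono[OF K[of "u x"], of 2] by (simp add: power_mult_distrib)
  qed
qed

lemma bounded_linear_axis: "bounded_linear (axis i :: 'b::euclidean_space \<Rightarrow> 'b^'n)"
  by (intro linear_conv_bounded_linear[THEN iffD1] linearI) (auto simp: axis_def vec_eq_iff)

lemma vec_L2I:
  fixes f :: "R3 \<Rightarrow> 'b::euclidean_space^'n"
  assumes "\<And>i. (\<lambda>x. f x $ i) \<in> L2 \<Omega>"
  shows "f \<in> L2 \<Omega>"
proof -
  have "(\<lambda>x. \<Sum>i\<in>UNIV. axis i (f x $ i) :: 'b^'n) \<in> L2 \<Omega>"
    by (intro L2_sum L2_bounded_linear[OF bounded_linear_axis] assms) simp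
  moreover have "(\<Sum>i\<in>UNIV. axis i (f x $ i)) = f x" for x
    by (simp add: vec_eq_iff axis_def if_distrib sum.delta cong: if_cong)
  ultimately show ?thesis by simp
qed

lemma vec_L2D:
  fixes f :: "R3 \<Rightarrow> 'b::euclidean_space^'n"
  shows "f \<in> L2 \<Omega> \<Longrightarrow> (\<lambda>x. f x $ i) \<in> L2 \<Omega>"
  by (rule L2_bounded_linear[OF bounded_linear_vec_nth])

lemma L2_inner_integrable:
  assumes u: "u \<in> L2 \<Omega>" and v: "v \<in> L2 \<Omega>"
  shows "integrable (lebesgue_on \<Omega>) (\<lambda>x. u x \<bullet> v x)"
proof (rule Bochner_Integration.integrable_bound)
  show "integrable (lebesgue_on \<Omega>) (\<lambda>x. (norm (u x))\<^sup>2 + (norm (v x))\<^sup>2)"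
    using L2_integrable_square[OF u] L2_integrable_square[OF v] by simp
  show "(\<lambda>x. u x \<bullet> v x) \<in> borel_measurable (lebesgue_on \<Omega>)"
    using L2_measurable[OF u] L2_measurable[OF v] by simp
  have "norm (u x \<bullet> v x) \<le> (norm (u x))\<^sup>2 + (norm (v x))\<^sup>2" for x
  proof -
    have "\<bar>u x \<bullet> v x\<bar> \<le> norm (u x) * norm (v x)" by (rule Cauchy_Schwarz_ineq2)
    also have "\<dots> \<le> (norm (u x))\<^sup>2 + (norm (v x))\<^sup>2"
      using sum_squares_bound[of "norm (u x)" "norm (v x)"]
        mult_nonneg_nonneg[OF norm_ge_zero[of "u x"] norm_ge_zero[of "v x"]] by linarith
    finally show ?thesis by simp
  qed
  then show "AE x in lebesgue_on \<Omega>. norm (u x \<bullet> v x) \<le> norm ((norm (u x))\<^sup>2 + (norm (v x))\<^sup>2)"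
    by simp
qed

lemma L2_mult_integrable:
  fixes u v :: "R3 \<Rightarrow> real"
  shows "u \<in> L2 \<Omega> \<Longrightarrow> v \<in> L2 \<Omega> \<Longrightarrow> integrable (lebesgue_on \<Omega>) (\<lambda>x. u x * v x)"
  using L2_inner_integrable[of u \<Omega> v] by simp

lemma L2_scaleR_integrable:
  fixes u :: "R3 \<Rightarrow> real" and v :: "R3 \<Rightarrow> 'b::euclidean_space"
  assumes "u \<in> L2 \<Omega>" "v \<in> L2 \<Omega>"
  shows "integrable (lebesgue_on \<Omega>) (\<lambda>x. u x *\<^sub>R v x)"
proof (rule Bochner_Integration.integrable_bound)
  show "integrable (lebesgue_on \<Omega>) (\<lambda>x. (norm (u x))\<^sup>2 + (norm (v x))\<^sup>2)"
    using assms by (simp add: L2_def)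
  show "(\<lambda>x. u x *\<^sub>R v x) \<in> borel_measurable (lebesgue_on \<Omega>)"
    using L2_measurable[OF assms(1)] L2_measurable[OF assms(2)] by simp
  have "\<bar>u x\<bar> * norm (v x) \<le> (norm (u x))\<^sup>2 + (norm (v x))\<^sup>2" for x
    using sum_squares_bound[of "norm (u x)" "norm (v x)"]
      mult_nonneg_nonneg[OF norm_ge_zero[of "u x"] norm_ge_zero[of "v x"]]
    unfolding real_norm_def[of "u x"] by linarith
  then show "AE x in lebesgue_on \<Omega>. norm (u x *\<^sub>R v x) \<le> norm ((norm (u x))\<^sup>2 + (norm (v x))\<^sup>2)"
    by simp
qed

lemma L2_inner_commute: "L2_inner \<Omega> u v = L2_inner \<Omega> v u"
  by (simp add: L2_inner_def inner_commute)

lemma L2_inner_lincomb_left: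
  assumes "u \<in> L2 \<Omega>" "v \<in> L2 \<Omega>" "w \<in> L2 \<Omega>"
  shows "L2_inner \<Omega> (\<lambda>x. a *\<^sub>R u x + c *\<^sub>R v x) w = a * L2_inner \<Omega> u w + c * L2_inner \<Omega> v w"
  unfolding L2_inner_def
  using L2_inner_integrable[OF assms(1,3)] L2_inner_integrable[OF assms(2,3)]
  by (simp add: inner_add_left)

lemma L2_inner_lincomb_right:
  assumes "u \<in> L2 \<Omega>" "v \<in> L2 \<Omega>" "w \<in> L2 \<Omega>"
  shows "L2_inner \<Omega> w (\<lambda>x. a *\<^sub>R u x + c *\<^sub>R v x) = a * L2_inner \<Omega> w u + c * L2_inner \<Omega> w v"
  using L2_inner_lincomb_left[OF assms] by (simp add: L2_inner_commute)

lemma L2_inner_diff_left: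
  assumes "u \<in> L2 \<Omega>" "v \<in> L2 \<Omega>" "w \<in> L2 \<Omega>"
  shows "L2_inner \<Omega> (\<lambda>x. u x - v x) w = L2_inner \<Omega> u w - L2_inner \<Omega> v w"
  using L2_inner_lincomb_left[OF assms, of 1 "-1"] by simp

lemma L2_inner_cong_AE:
  assumes "u \<in> L2 \<Omega>" "u' \<in> L2 \<Omega>" "ae_eq \<Omega> u u'" "v \<in> L2 \<Omega>" "v' \<in> L2 \<Omega>" "ae_eq \<Omega> v v'"
  shows "L2_inner \<Omega> u v = L2_inner \<Omega> u' v'"
  unfolding L2_inner_def
proof (rule integral_cong_AE)
  show "AE x in lebesgue_on \<Omega>. u x \<bullet> v x = u' x \<bullet> v' x"
    using assms(3,6) unfolding ae_eq_def by eventually_elim simp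
qed (use assms in \<open>auto dest: L2_measurable\<close>)

lemma L2_inner_self: "L2_inner \<Omega> u u = (L2_norm \<Omega> u)\<^sup>2"
  by (simp add: L2_inner_def L2_norm_def dot_square_norm)

lemma L2_norm_nonneg: "0 \<le> L2_norm \<Omega> u"
  by (simp add: L2_norm_def)

lemma L2_inner_self_eq_0:
  assumes "u \<in> L2 \<Omega>" "L2_inner \<Omega> u u = 0"
  shows "AE x in lebesgue_on \<Omega>. u x = 0"
  using integral_nonneg_eq_0_iff_AE[OF L2_integrable_square[OF assms(1)]] assms(2)
  by (simp add: L2_inner_def dot_square_norm)

lemma L2_inner_self_lincomb:
  assumes u: "u \<in> L2 \<Omega>" and v: "v \<in> L2 \<Omega>"
  shows "L2_inner \<Omega> (\<lambda>x. a *\<^sub>R u x + c *\<^sub>R v x) (\<lambda>x. a *\<^sub>R u x + c *\<^sub>R v x)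
    = a\<^sup>2 * L2_inner \<Omega> u u + 2 * a * c * L2_inner \<Omega> u v + c\<^sup>2 * L2_inner \<Omega> v v"
  by (simp add: L2_inner_lincomb_left L2_inner_lincomb_right L2_lincomb u v
      L2_inner_commute[of \<Omega> v u] power2_eq_square algebra_simps)

text \<open>The degenerate case \<open>C = 0\<close> is included because the L2 form is only
  semidefinite on functions. Besides Cauchy-Schwarz, this serves the projection theorem: with
  \<open>A = 0\<close> it says that a vanishing minimum at \<open>t = 0\<close> forces the linear
  term to vanish.\<close>

lemma quadratic_nonneg_discriminant:
  fixes A B C :: real
  assumes "\<And>t. 0 \<le> A + 2 * t * B + t\<^sup>2 * C" and "0 \<le> C"
  shows "B\<^sup>2 \<le> A * C"
proof (cases "C = 0")
  case True
  have "B = 0"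
  proof (rule ccontr)
    assume "B \<noteq> 0"
    \<comment> \<open>At this \<open>t\<close> the affine function \<open>A + 2 * t * B\<close>
      takes the value -1.\<close>
    then have "2 * (- (A + 1) / (2 * B)) * B = - (A + 1)" by simp
    then show False using assms(1)[of "- (A + 1) / (2 * B)"] True by simp
  qed
  then show ?thesis using True by simp
next
  case False
  then have "C > 0" using assms(2) by simp
  \<comment> \<open>The polynomial is evaluated at its minimiser \<open>- B / C\<close>.\<close>
  have "0 \<le> C * (A + 2 * (- B / C) * B + (- B / C)\<^sup>2 * C)"
    using assms(1)[of "- B / C"] \<open>C > 0\<close> by (intro mult_nonneg_nonneg) auto
  also have "\<dots> = A * C - B\<^sup>2"
    using \<open>C > 0\<close> by (simp add: field_simps power2_eq_square)
  finally show ?thesis by simp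
qed

lemma L2_inner_self_nonneg: "0 \<le> L2_inner \<Omega> u u"
  by (simp add: L2_inner_self)

lemma L2_Cauchy_Schwarz:
  assumes u: "u \<in> L2 \<Omega>" and v: "v \<in> L2 \<Omega>"
  shows "\<bar>L2_inner \<Omega> u v\<bar> \<le> L2_norm \<Omega> u * L2_norm \<Omega> v"
proof -
  have "(L2_inner \<Omega> u v)\<^sup>2 \<le> L2_inner \<Omega> u u * L2_inner \<Omega> v v"
  proof (rule quadratic_nonneg_discriminant)
    show "0 \<le> L2_inner \<Omega> u u + 2 * t * L2_inner \<Omega> u v + t\<^sup>2 * L2_inner \<Omega> v v" for t
      using L2_inner_self_nonneg[of \<Omega> "\<lambda>x. 1 *\<^sub>R u x + t *\<^sub>R v x"]
      unfolding L2_inner_self_lincomb[OF u v] by simp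
  qed (rule L2_inner_self_nonneg)
  then have "(L2_inner \<Omega> u v)\<^sup>2 \<le> (L2_norm \<Omega> u * L2_norm \<Omega> v)\<^sup>2"
    by (simp add: L2_inner_self power_mult_distrib)
  then show ?thesis
    by (metis L2_norm_nonneg abs_le_square_iff abs_of_nonneg mult_nonneg_nonneg)
qed

section \<open>Triangle inequality, completeness of L2 and orthogonal projection\<close>

lemma L2_norm_triangle:
  assumes u: "u \<in> L2 \<Omega>" and v: "v \<in> L2 \<Omega>"
  shows "L2_norm \<Omega> (\<lambda>x. u x + v x) \<le> L2_norm \<Omega> u + L2_norm \<Omega> v"
proof (rule power2_le_imp_le)
  have "(L2_norm \<Omega> (\<lambda>x. u x + v x))\<^sup>2
      = (L2_norm \<Omega> u)\<^sup>2 + 2 * L2_inner \<Omega> u v + (L2_norm \<Omega> v)\<^sup>2"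
    using L2_inner_self_lincomb[OF u v, of 1 1] by (simp add: L2_inner_self)
  also have "\<dots> \<le> (L2_norm \<Omega> u + L2_norm \<Omega> v)\<^sup>2"
    using L2_Cauchy_Schwarz[OF u v] by (simp add: power2_sum)
  finally show "(L2_norm \<Omega> (\<lambda>x. u x + v x))\<^sup>2 \<le> (L2_norm \<Omega> u + L2_norm \<Omega> v)\<^sup>2" .
qed (simp add: L2_norm_nonneg)

text \<open>The parallelogram law for the vectors \<open>w - u\<close> and \<open>w - v\<close>: up
  to sign their difference is \<open>u - v\<close>, and half their sum is \<open>w\<close> minus the
  midpoint of \<open>u\<close> and \<open>v\<close>. In this form it shows that minimising sequences
  are Cauchy.\<close>

lemma L2_parallelogram:
  assumes u: "u \<in> L2 \<Omega>" and v: "v \<in> L2 \<Omega>" and w: "w \<in> L2 \<Omega>"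
  shows "(L2_norm \<Omega> (\<lambda>x. u x - v x))\<^sup>2 + 4 * (L2_norm \<Omega> (\<lambda>x. w x - ((1/2) *\<^sub>R u x + (1/2) *\<^sub>R v x)))\<^sup>2
    = 2 * (L2_norm \<Omega> (\<lambda>x. w x - u x))\<^sup>2 + 2 * (L2_norm \<Omega> (\<lambda>x. w x - v x))\<^sup>2"
proof -
  let ?a = "\<lambda>x. w x - u x" and ?b = "\<lambda>x. w x - v x"
  have a: "?a \<in> L2 \<Omega>" and b: "?b \<in> L2 \<Omega>" using assms by (auto intro: L2_diff)
  have 1: "(\<lambda>x. u x - v x) = (\<lambda>x. (-1) *\<^sub>R ?a x + 1 *\<^sub>R ?b x)" by simp
  have "w x = (1/2) *\<^sub>R w x + (1/2) *\<^sub>R w x" for x by (simp flip: scaleR_left_distrib)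
  then have "w x - ((1/2) *\<^sub>R u x + (1/2) *\<^sub>R v x) = (1/2) *\<^sub>R ?a x + (1/2) *\<^sub>R ?b x" for x
    by (simp add: algebra_simps)
  then have 2: "(\<lambda>x. w x - ((1/2) *\<^sub>R u x + (1/2) *\<^sub>R v x)) = (\<lambda>x. (1/2) *\<^sub>R ?a x + (1/2) *\<^sub>R ?b x)"
    by blast
  show ?thesis
    unfolding 1 2 L2_inner_self[symmetric] L2_inner_self_lincomb[OF a b]
    by (simp add: field_simps power2_eq_square)
qed

text \<open>On a finite measure space Cauchy-Schwarz against the constant 1 bounds the L1 norm by
  the L2 norm, which gives a subsequence converging almost everywhere. Fatou's lemma along that
  subsequence carries the L2 Cauchy estimate over to the limit.\<close>

lemma L2_Cauchy_limit:
  fixes s :: "nat \<Rightarrow> R3 \<Rightarrow> 'b::euclidean_space"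
  assumes fin: "finite_measure (lebesgue_on \<Omega>)"
    and s: "\<And>n. s n \<in> L2 \<Omega>"
    and C: "\<And>e. e > 0 \<Longrightarrow> \<exists>N. \<forall>i\<ge>N. \<forall>j\<ge>N. L2_norm \<Omega> (\<lambda>x. s i x - s j x) < e"
  obtains p where "p \<in> L2 \<Omega>" "(\<lambda>n. L2_norm \<Omega> (\<lambda>x. p x - s n x)) \<longlonglongrightarrow> 0"
proof -
  interpret finite_measure "lebesgue_on \<Omega>" by (rule fin)
  let ?M = "lebesgue_on \<Omega>"
  have [measurable]: "s n \<in> borel_measurable ?M" for n using s by (rule L2_measurable)
  have one: "(\<lambda>x. 1::real) \<in> L2 \<Omega>" by (simp add: L2_def)
  have normL2: "(\<lambda>x. norm (f x)) \<in> L2 \<Omega>" if "f \<in> L2 \<Omega>" for f :: "R3 \<Rightarrow> 'b"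
    using that by (auto simp: L2_def)
  have L1: "integrable ?M f" if "f \<in> L2 \<Omega>" for f :: "R3 \<Rightarrow> 'b"
    using L2_scaleR_integrable[OF one that] by simp
  have L1_bound: "(\<integral>x. norm (f x) \<partial>?M) \<le> L2_norm \<Omega> f * L2_norm \<Omega> (\<lambda>x. 1::real)" if "f \<in> L2 \<Omega>" for f :: "R3 \<Rightarrow> 'b"
    using L2_Cauchy_Schwarz[OF normL2[OF that] one] by (simp add: L2_inner_def L2_norm_def)
  \<comment> \<open>The summand 1 keeps \<open>c\<close> positive, as it becomes a divisor, even
    when \<Omega> is a null set.\<close>
  define c where "c = L2_norm \<Omega> (\<lambda>x. 1::real) + 1"
  have c: "c > 0" "L2_norm \<Omega> (\<lambda>x. 1::real) \<le> c" using L2_norm_nonneg[of \<Omega> "\<lambda>x. 1::real"] by (auto simp: c_def)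
  obtain r where r: "strict_mono r" "AE x in ?M. Cauchy (\<lambda>i. s (r i) x)"
  proof (rule cauchy_L1_AE_cauchy_subseq[of ?M s])
    show "integrable ?M (s n)" for n using L1 s by blast
    show "\<exists>N. \<forall>i\<ge>N. \<forall>j\<ge>N. (LINT x|?M. norm (s i x - s j x)) < e" if "e > 0" for e
    proof -
      obtain N where N: "\<And>i j. i \<ge> N \<Longrightarrow> j \<ge> N \<Longrightarrow> L2_norm \<Omega> (\<lambda>x. s i x - s j x) < e / c"
        using C[of "e / c"] \<open>e > 0\<close> c by auto
      have "(LINT x|?M. norm (s i x - s j x)) < e" if "i \<ge> N" "j \<ge> N" for i j
      proof -
        have "(LINT x|?M. norm (s i x - s j x)) \<le> L2_norm \<Omega> (\<lambda>x. s i x - s j x) * L2_norm \<Omega> (\<lambda>x. 1::real)"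
          by (rule L1_bound) (intro L2_diff s)
        also have "\<dots> \<le> L2_norm \<Omega> (\<lambda>x. s i x - s j x) * c"
          using c by (intro mult_left_mono L2_norm_nonneg)
        also have "\<dots> < e" using N[OF that] c by (simp add: field_simps)
        finally show ?thesis .
      qed
      then show ?thesis by blast
    qed
  qed auto
  define p where "p = (\<lambda>x. lim (\<lambda>i. s (r i) x))"
  have p_meas [measurable]: "p \<in> borel_measurable ?M" unfolding p_def by measurable
  have p_lim: "AE x in ?M. (\<lambda>i. s (r i) x) \<longlonglongrightarrow> p x"
    using r(2) unfolding p_def by eventually_elim (simp add: Cauchy_convergent_iff convergent_LIMSEQ_iff)
  have r_ge: "r i \<ge> i" for i using r(1) by (rule seq_suble)
  \<comment> \<open>Membership in L2 and the estimate come from the same Fatou bound. Since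
    \<open>r i \<ge> i\<close>, the indices \<open>r i\<close> with \<open>i \<ge> N\<close> stay in
    the range of the Cauchy estimate.\<close>
  have tail: "(\<lambda>x. p x - s n x) \<in> L2 \<Omega> \<and> L2_norm \<Omega> (\<lambda>x. p x - s n x) \<le> e"
    if N: "\<forall>i\<ge>N. \<forall>j\<ge>N. L2_norm \<Omega> (\<lambda>x. s i x - s j x) < e" and n: "n \<ge> N" and e: "e > 0" for n N e
  proof -
    have "(\<integral>\<^sup>+x. ennreal ((norm (p x - s n x))\<^sup>2) \<partial>?M)
        = (\<integral>\<^sup>+x. liminf (\<lambda>i. ennreal ((norm (s (r i) x - s n x))\<^sup>2)) \<partial>?M)"
    proof (rule nn_integral_cong_AE, use p_lim in eventually_elim)
      case (elim x)
      have "(\<lambda>i. ennreal ((norm (s (r i) x - s n x))\<^sup>2)) \<longlonglongrightarrow> ennreal ((norm (p x - s n x))\<^sup>2)"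
        by (intro tendsto_ennrealI tendsto_intros elim)
      then show ?case by (intro lim_imp_Liminf[symmetric]) auto
    qed
    also have "\<dots> \<le> liminf (\<lambda>i. \<integral>\<^sup>+x. ennreal ((norm (s (r i) x - s n x))\<^sup>2) \<partial>?M)"
      by (rule nn_integral_liminf) measurable
    also have "\<dots> \<le> ennreal (e\<^sup>2)"
    proof (rule Liminf_le)
      have "(\<integral>\<^sup>+x. ennreal ((norm (s (r i) x - s n x))\<^sup>2) \<partial>?M) \<le> ennreal (e\<^sup>2)" if "i \<ge> N" for i
      proof -
        have L: "(\<lambda>x. s (r i) x - s n x) \<in> L2 \<Omega>" by (intro L2_diff s)
        have "(\<integral>\<^sup>+x. ennreal ((norm (s (r i) x - s n x))\<^sup>2) \<partial>?M) = ennreal ((L2_norm \<Omega> (\<lambda>x. s (r i) x - s n x))\<^sup>2)"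
          using nn_integral_eq_integral[OF L2_integrable_square[OF L]] by (simp add: L2_norm_def)
        also have "\<dots> \<le> ennreal (e\<^sup>2)"
          using N r_ge[of i] that n L2_norm_nonneg
          by (intro ennreal_leI power_mono) (auto intro: less_imp_le)
        finally show ?thesis .
      qed
      then show "\<forall>\<^sub>F i in sequentially. (\<integral>\<^sup>+x. ennreal ((norm (s (r i) x - s n x))\<^sup>2) \<partial>?M) \<le> ennreal (e\<^sup>2)"
        by (auto simp: eventually_sequentially)
    qed simp
    finally have *: "(\<integral>\<^sup>+x. ennreal ((norm (p x - s n x))\<^sup>2) \<partial>?M) \<le> ennreal (e\<^sup>2)" .
    then have "integrable ?M (\<lambda>x. (norm (p x - s n x))\<^sup>2)"
      by (intro integrableI_bounded) (auto simp: top.not_eq_extremum intro: le_less_trans)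
    then have ps: "(\<lambda>x. p x - s n x) \<in> L2 \<Omega>" by (simp add: L2_def)
    moreover have "(L2_norm \<Omega> (\<lambda>x. p x - s n x))\<^sup>2 \<le> e\<^sup>2"
      using * nn_integral_eq_integral[OF L2_integrable_square[OF ps]] by (simp add: L2_norm_def)
    ultimately show ?thesis using e by (auto intro: power2_le_imp_le)
  qed
  show thesis
  proof
    obtain N where "\<forall>i\<ge>N. \<forall>j\<ge>N. L2_norm \<Omega> (\<lambda>x. s i x - s j x) < 1"
      using C[of 1] by auto
    then have "(\<lambda>x. p x - s N x) \<in> L2 \<Omega>" using tail[of N 1 N] by simp
    from L2_add[OF this s[of N]] show "p \<in> L2 \<Omega>" by simp
    show "(\<lambda>n. L2_norm \<Omega> (\<lambda>x. p x - s n x)) \<longlonglongrightarrow> 0"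
    proof (rule LIMSEQ_I)
      fix e :: real assume "e > 0"
      then obtain N where "\<forall>i\<ge>N. \<forall>j\<ge>N. L2_norm \<Omega> (\<lambda>x. s i x - s j x) < e / 2"
        using C[of "e / 2"] half_gt_zero by blast
      then have "\<forall>n\<ge>N. L2_norm \<Omega> (\<lambda>x. p x - s n x) \<le> e / 2"
      using tail[of N "e / 2"] \<open>e > 0\<close> by simp
      then show "\<exists>no. \<forall>n\<ge>no. norm (L2_norm \<Omega> (\<lambda>x. p x - s n x) - 0) < e"
        using \<open>e > 0\<close> by (intro exI[of _ N]) (force simp: abs_of_nonneg[OF L2_norm_nonneg])
    qed
  qed
qed

text \<open>The annihilator of any set is a subspace closed under L2 limits, so a minimising
  sequence for the distance to \<open>u\<close> has its limit in \<open>S\<close>. The residual is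
  orthogonal to \<open>S\<close> because the first variation vanishes at a minimum.\<close>

lemma L2_projection:
  fixes u :: "R3 \<Rightarrow> 'b::euclidean_space"
  assumes fin: "finite_measure (lebesgue_on \<Omega>)" and A: "A \<subseteq> L2 \<Omega>" and u: "u \<in> L2 \<Omega>"
  defines "S \<equiv> {p \<in> L2 \<Omega>. \<forall>a\<in>A. L2_inner \<Omega> p a = 0}"
  obtains p where "p \<in> S" "\<forall>s\<in>S. L2_inner \<Omega> (\<lambda>x. u x - p x) s = 0"
proof -
  have S_lin: "(\<lambda>x. a *\<^sub>R p x + c *\<^sub>R q x) \<in> S" if "p \<in> S" "q \<in> S" for p q a c
    using that A by (auto simp: S_def L2_lincomb L2_inner_lincomb_left subset_iff)
  have S_L2: "p \<in> L2 \<Omega>" if "p \<in> S" for p using that by (simp add: S_def)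
  define D where "D = (\<lambda>p. L2_norm \<Omega> (\<lambda>x. u x - p x)) ` S"
  define d where "d = Inf D"
  have zS: "(\<lambda>x. 0) \<in> S" by (simp add: S_def L2_zero L2_inner_def)
  then have D_ne: "D \<noteq> {}" by (auto simp: D_def)
  have D_bdd: "bdd_below D" by (rule bdd_belowI[of _ 0]) (auto simp: D_def L2_norm_nonneg)
  have d_le: "d \<le> L2_norm \<Omega> (\<lambda>x. u x - p x)" if "p \<in> S" for p
    unfolding d_def using that D_bdd by (auto intro: cInf_lower simp: D_def)
  have d0: "d \<ge> 0" unfolding d_def using D_ne by (rule cInf_greatest) (auto simp: D_def L2_norm_nonneg)
  have "\<exists>p\<in>S. L2_norm \<Omega> (\<lambda>x. u x - p x) < d + e" if "e > 0" for e
    using cInf_lessD[OF D_ne, of "d + e"] that unfolding d_def D_def by auto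
  then have "\<exists>p\<in>S. L2_norm \<Omega> (\<lambda>x. u x - p x) < d + 1 / real (Suc n)" for n
    by simp
  then obtain s where s: "\<And>n. s n \<in> S" "\<And>n. L2_norm \<Omega> (\<lambda>x. u x - s n x) < d + 1 / real (Suc n)"
    by metis
  have lim: "(\<lambda>n. L2_norm \<Omega> (\<lambda>x. u x - s n x)) \<longlonglongrightarrow> d"
  proof (rule tendsto_sandwich[OF _ _ tendsto_const])
    show "(\<lambda>n. d + 1 / real (Suc n)) \<longlonglongrightarrow> d"
      using tendsto_add[OF tendsto_const LIMSEQ_inverse_real_of_nat, of d] by (simp add: inverse_eq_divide)
  qed (use s d_le in \<open>auto intro!: always_eventually intro: less_imp_le\<close>)
  have "\<exists>N. \<forall>i\<ge>N. \<forall>j\<ge>N. L2_norm \<Omega> (\<lambda>x. s i x - s j x) < e" if "e > 0" for e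
  proof -
    have "(\<lambda>n. (L2_norm \<Omega> (\<lambda>x. u x - s n x))\<^sup>2) \<longlonglongrightarrow> d\<^sup>2" by (intro tendsto_power lim)
    \<comment> \<open>Each of the two distances enters the parallelogram law with a factor 2, so the
      two margins \<open>e\<^sup>2 / 4\<close> add up to \<open>e\<^sup>2\<close>.\<close>
    then obtain N where N: "\<And>n. n \<ge> N \<Longrightarrow> (L2_norm \<Omega> (\<lambda>x. u x - s n x))\<^sup>2 < d\<^sup>2 + e\<^sup>2 / 4"
      using order_tendstoD(2)[of _ "d\<^sup>2" sequentially "d\<^sup>2 + e\<^sup>2 / 4"] \<open>e > 0\<close>
      by (auto simp: eventually_sequentially)
    have "L2_norm \<Omega> (\<lambda>x. s i x - s j x) < e" if "i \<ge> N" "j \<ge> N" for i j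
    proof -
      \<comment> \<open>The midpoint of \<open>s i\<close> and \<open>s j\<close> lies in
        \<open>S\<close>, so its distance from \<open>u\<close> is at least
        \<open>d\<close>.\<close>
      have "d\<^sup>2 \<le> (L2_norm \<Omega> (\<lambda>x. u x - ((1/2) *\<^sub>R s i x + (1/2) *\<^sub>R s j x)))\<^sup>2"
        using d_le[OF S_lin[OF s(1)[of i] s(1)[of j]]] d0 by (intro power_mono)
      then have "(L2_norm \<Omega> (\<lambda>x. s i x - s j x))\<^sup>2 < e\<^sup>2"
        using L2_parallelogram[OF S_L2[OF s(1)[of i]] S_L2[OF s(1)[of j]] u]
          N[OF that(1)] N[OF that(2)] by linarith
      then show ?thesis using \<open>e > 0\<close> by (auto intro: power2_less_imp_less)
    qed
    then show ?thesis by blast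
  qed
  then obtain p where p: "p \<in> L2 \<Omega>" and plim: "(\<lambda>n. L2_norm \<Omega> (\<lambda>x. p x - s n x)) \<longlonglongrightarrow> 0"
    by (rule L2_Cauchy_limit[OF fin S_L2[OF s(1)]])
  have pS: "p \<in> S"
  proof -
    have "L2_inner \<Omega> p a = 0" if "a \<in> A" for a
    proof -
      have a: "a \<in> L2 \<Omega>" using that A by blast
      \<comment> \<open>As \<open>s n\<close> annihilates \<open>a\<close>, the left-hand side is
        also the inner product of \<open>p - s n\<close> with \<open>a\<close>.\<close>
      have "\<bar>L2_inner \<Omega> p a\<bar> \<le> L2_norm \<Omega> (\<lambda>x. p x - s n x) * L2_norm \<Omega> a" for n
        using L2_Cauchy_Schwarz[OF L2_diff[OF p S_L2[OF s(1)]] a, of n] s(1)[of n] that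
        by (simp add: L2_inner_diff_left p a S_L2[OF s(1)] S_def)
      moreover have "(\<lambda>n. L2_norm \<Omega> (\<lambda>x. p x - s n x) * L2_norm \<Omega> a) \<longlonglongrightarrow> 0 * L2_norm \<Omega> a"
        by (intro tendsto_mult plim tendsto_const)
      ultimately have "\<bar>L2_inner \<Omega> p a\<bar> \<le> 0 * L2_norm \<Omega> a"
        by (intro LIMSEQ_le_const) auto
      then show ?thesis by simp
    qed
    then show ?thesis using p by (simp add: S_def)
  qed
  have pd: "L2_norm \<Omega> (\<lambda>x. u x - p x) \<le> d"
  proof -
    have "L2_norm \<Omega> (\<lambda>x. u x - p x) \<le> L2_norm \<Omega> (\<lambda>x. u x - s n x) + L2_norm \<Omega> (\<lambda>x. p x - s n x)" for n
    proof -
      have "L2_norm \<Omega> (\<lambda>x. s n x - p x) = L2_norm \<Omega> (\<lambda>x. p x - s n x)"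
        by (simp add: L2_norm_def norm_minus_commute)
      then show ?thesis
        using L2_norm_triangle[OF L2_diff[OF u S_L2[OF s(1)]] L2_diff[OF S_L2[OF s(1)] p], of n n]
        by simp
    qed
    moreover have "(\<lambda>n. L2_norm \<Omega> (\<lambda>x. u x - s n x) + L2_norm \<Omega> (\<lambda>x. p x - s n x)) \<longlonglongrightarrow> d + 0"
      by (intro tendsto_add lim plim)
    ultimately have "L2_norm \<Omega> (\<lambda>x. u x - p x) \<le> d + 0"
      by (intro LIMSEQ_le_const) auto
    then show ?thesis by simp
  qed
  show thesis
  proof
    show "p \<in> S" by (rule pS)
    show "\<forall>q\<in>S. L2_inner \<Omega> (\<lambda>x. u x - p x) q = 0"
    proof
      fix q assume q: "q \<in> S"
      let ?w = "\<lambda>x. u x - p x"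
      have w: "?w \<in> L2 \<Omega>" by (intro L2_diff u p)
      \<comment> \<open>Moving from \<open>p\<close> by \<open>- t\<close> times \<open>q\<close>
        stays in \<open>S\<close> and cannot reduce the squared distance; the literal 0 is the
        \<open>A\<close> of the discriminant lemma.\<close>
      have "0 \<le> 0 + 2 * t * L2_inner \<Omega> ?w q + t\<^sup>2 * L2_inner \<Omega> q q" for t
      proof -
        have "(L2_norm \<Omega> ?w)\<^sup>2 \<le> d\<^sup>2" using pd L2_norm_nonneg by (intro power_mono)
        also have "d \<le> L2_norm \<Omega> (\<lambda>x. u x - (1 *\<^sub>R p x + (- t) *\<^sub>R q x))"
          by (intro d_le S_lin pS q)
        then have "d\<^sup>2 \<le> (L2_norm \<Omega> (\<lambda>x. u x - (1 *\<^sub>R p x + (- t) *\<^sub>R q x)))\<^sup>2"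
          using d0 by (intro power_mono)
        also have "(\<lambda>x. u x - (1 *\<^sub>R p x + (- t) *\<^sub>R q x)) = (\<lambda>x. 1 *\<^sub>R ?w x + t *\<^sub>R q x)"
          by (simp add: algebra_simps)
        finally show ?thesis
          using L2_inner_self_lincomb[OF w S_L2[OF q], of 1 t] by (simp add: L2_inner_self)
      qed
      then have "(L2_inner \<Omega> ?w q)\<^sup>2 \<le> 0 * L2_inner \<Omega> q q"
        by (rule quadratic_nonneg_discriminant) (rule L2_inner_self_nonneg)
      then show "L2_inner \<Omega> ?w q = 0" by simp
    qed
  qed
qed

subsection \<open>Smooth functions\<close>

lemma grad_eq:
  assumes "(f has_derivative D) (at x)"
  shows "grad f x $ i = D (axis i 1)"
  using frechet_derivative_at[OF assms] by (simp add: grad_def)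

lemma differentiable_has_grad:
  fixes f :: "R3 \<Rightarrow> real"
  assumes "f differentiable (at x)"
  shows "(f has_derivative frechet_derivative f (at x)) (at x)"
  using assms by (simp add: frechet_derivative_works)

text \<open>The product rule places undifferentiated factors next to derivatives, so the induction
  in \<open>Ck_mult\<close> has to lower the order of its factors.\<close>

lemma Ck_SucD: "Ck (Suc n) f \<Longrightarrow> Ck n f"
proof (induction n arbitrary: f)
  case 0
  then show ?case
    by (auto intro!: continuous_at_imp_continuous_on differentiable_imp_continuous_within)
qed simp

lemma Ck_const: "Ck n (\<lambda>x. c)"
proof (induction n arbitrary: c)
  case (Suc n)
  have "grad (\<lambda>x. c) x $ i = 0" for x i by (rule grad_eq) simp
  then show ?case using Suc by simp
qed simp

lemma Ck_add: "Ck n f \<Longrightarrow> Ck n g \<Longrightarrow> Ck n (\<lambda>x. f x + g x)"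
proof (induction n arbitrary: f g)
  case (Suc n)
  then have d: "f differentiable (at x)" "g differentiable (at x)" for x by auto
  have "grad (\<lambda>x. f x + g x) x $ i = grad f x $ i + grad g x $ i" for x i
    using grad_eq[OF has_derivative_add[OF d[THEN differentiable_has_grad]]] by (simp add: grad_def)
  then show ?case using Suc by simp
qed (auto intro: continuous_intros)

lemma Ck_mult: "Ck n f \<Longrightarrow> Ck n g \<Longrightarrow> Ck n (\<lambda>x. f x * g x)"
proof (induction n arbitrary: f g)
  case (Suc n)
  then have d: "f differentiable (at x)" "g differentiable (at x)" for x by auto
  have "grad (\<lambda>x. f x * g x) x $ i = f x * grad g x $ i + grad f x $ i * g x" for x i
    using grad_eq[OF has_derivative_mult[OF d[THEN differentiable_has_grad]]] by (simp add: grad_def)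
  moreover have "Ck n (\<lambda>x. f x * grad g x $ i + grad f x $ i * g x)" for i
    using Suc.prems by (intro Ck_add Suc.IH Ck_SucD[OF Suc.prems(1)] Ck_SucD[OF Suc.prems(2)]) auto
  ultimately show ?case using d by (simp add: differentiable_mult)
qed (auto intro: continuous_intros)

lemma Ck_prod: "finite I \<Longrightarrow> (\<And>i. i \<in> I \<Longrightarrow> Ck n (f i)) \<Longrightarrow> Ck n (\<lambda>x. \<Prod>i\<in>I. f i x)"
  by (induction I rule: finite_induct) (auto intro: Ck_mult Ck_const)

text \<open>The derivatives of \<open>flat_exp c 0\<close> are linear combinations of the functions \<open>flat_exp c k\<close>,
  so that smoothness can be proved by induction over the whole family.\<close>

definition flat_exp :: "real \<Rightarrow> nat \<Rightarrow> real \<Rightarrow> real" where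
  "flat_exp c k t = (if t > 0 then (1/t)^k * exp (- c / t) else 0)"

text \<open>From the left the function is identically 0. From the right, substituting
  \<open>s\<close> for the inverse of \<open>t\<close> gives a constant multiple of
  \<open>(c * s)^k / exp (c * s)\<close>, where the exponential wins.\<close>

lemma flat_exp_tendsto_0:
  assumes "c > 0"
  shows "(flat_exp c k \<longlongrightarrow> 0) (at 0)"
proof (rule filterlim_split_at)
  show "(flat_exp c k \<longlongrightarrow> 0) (at_left 0)"
    by (rule tendsto_eventually) (auto simp: eventually_at_filter flat_exp_def)
  have "((\<lambda>s. (1/c)^k * ((c * s)^k / exp (c * s))) \<longlongrightarrow> (1/c)^k * 0) at_top"
    using assms by (intro tendsto_mult tendsto_const filterlim_compose[OF tendsto_power_div_exp_0]
      filterlim_tendsto_pos_mult_at_top[OF tendsto_const] filterlim_ident)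
  then have "((\<lambda>t. (1/c)^k * ((c * inverse t)^k / exp (c * inverse t))) \<longlongrightarrow> 0) (at_right 0)"
    using filterlim_compose[OF _ filterlim_inverse_at_top_right] by simp
  moreover have "(1/c)^k * ((c * inverse t)^k / exp (c * inverse t)) = flat_exp c k t" if "t > 0" for t
  proof -
    have "(1/c)^k * (c * inverse t)^k = (1/t)^k"
      using assms by (simp add: field_simps flip: power_mult_distrib)
    then show ?thesis using that by (simp add: flat_exp_def exp_minus divide_inverse)
  qed
  then have "\<forall>\<^sub>F t in at_right 0. (1/c)^k * ((c * inverse t)^k / exp (c * inverse t)) = flat_exp c k t"
    by (simp add: eventually_at_filter)
  ultimately show "(flat_exp c k \<longlongrightarrow> 0) (at_right 0)"
    by (rule Lim_transform_eventually)
qed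

lemma flat_exp_deriv:
  assumes c: "c > 0"
  shows "(flat_exp c k has_real_derivative
           (c * flat_exp c (Suc (Suc k)) t - of_nat k * flat_exp c (Suc k) t)) (at t)"
proof -
  consider "t > 0" | "t < 0" | "t = 0" by linarith
  then show ?thesis
  proof cases
    case 1
    \<comment> \<open>Differentiating in the variable 1/t leaves a power times an exponential, and
      the chain rule contributes the factor that raises the exponent by two.\<close>
    let ?s = "inverse t"
    have "((\<lambda>s. s^k * exp (- c * s)) has_real_derivative
        (of_nat k * ?s^(k - 1) * exp (- c * ?s) + ?s^k * (exp (- c * ?s) * - c))) (at ?s)"
      by (auto intro!: derivative_eq_intros)
    from DERIV_chain2[OF this DERIV_inverse] 1
    have "((\<lambda>t. (inverse t)^k * exp (- c * inverse t)) has_real_derivative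
        (of_nat k * ?s^(k - 1) * exp (- c * ?s) + ?s^k * (exp (- c * ?s) * - c)) * - (?s ^ Suc (Suc 0))) (at t)"
      by simp
    also have "(of_nat k * ?s^(k - 1) * exp (- c * ?s) + ?s^k * (exp (- c * ?s) * - c)) * - (?s ^ Suc (Suc 0))
        = c * (?s^(Suc (Suc k)) * exp (- c * ?s)) - of_nat k * (?s^Suc k * exp (- c * ?s))"
      \<comment> \<open>For \<open>k = 0\<close> the truncated \<open>k - 1\<close> is harmless,
        since that term carries the factor \<open>k\<close>.\<close>
      by (cases k) (simp_all add: algebra_simps)
    also have "\<dots> = c * flat_exp c (Suc (Suc k)) t - of_nat k * flat_exp c (Suc k) t"
      using 1 by (simp add: flat_exp_def divide_inverse)
    finally have "((\<lambda>t. (inverse t)^k * exp (- c * inverse t)) has_real_derivative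
        (c * flat_exp c (Suc (Suc k)) t - of_nat k * flat_exp c (Suc k) t)) (at t)" .
    then show ?thesis
      by (rule has_field_derivative_transform_within_open[of _ _ _ "{0<..}"])
         (use 1 in \<open>auto simp: flat_exp_def divide_inverse\<close>)
  next
    case 2
    have "((\<lambda>t. 0) has_real_derivative
        (c * flat_exp c (Suc (Suc k)) t - of_nat k * flat_exp c (Suc k) t)) (at t)"
      using 2 by (simp add: flat_exp_def)
    then show ?thesis
      by (rule has_field_derivative_transform_within_open[of _ _ _ "{..<0}"])
         (use 2 in \<open>auto simp: flat_exp_def\<close>)
  next
    case 3
    \<comment> \<open>The difference quotient at 0 is the next member of the family, so
      differentiability there is the limit already computed.\<close>
    have "(flat_exp c k (0 + h) - flat_exp c k 0) / h = flat_exp c (Suc k) h" for h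
      by (simp add: flat_exp_def)
    then have "(flat_exp c k has_real_derivative 0) (at 0)"
      using flat_exp_tendsto_0[OF c, of "Suc k"] by (simp only: DERIV_def)
    then show ?thesis using 3 by (simp add: flat_exp_def)
  qed
qed

text \<open>The exponent is generalised because differentiation raises it. The affine argument
  yields both \<open>x $ i - a $ i\<close> and \<open>b $ i - x $ i\<close>, the distances to
  opposite faces of a box.\<close>

lemma Ck_flat_exp:
  assumes c: "c > 0"
  shows "Ck n (\<lambda>x. flat_exp c k (a * x $ i + b))"
proof (induction n arbitrary: k)
  case 0
  have "continuous_on UNIV (flat_exp c k)"
    using flat_exp_deriv[OF c] by (intro DERIV_continuous_on) auto
  then have "continuous_on UNIV (flat_exp c k \<circ> (\<lambda>x::R3. a * x $ i + b))"
    by (intro continuous_on_compose continuous_intros) (auto intro: continuous_on_subset)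
  then show ?case by (simp add: o_def)
next
  case (Suc n)
  let ?f = "\<lambda>x::R3. flat_exp c k (a * x $ i + b)"
  let ?d = "\<lambda>x::R3. c * flat_exp c (Suc (Suc k)) (a * x $ i + b)
    + (- of_nat k) * flat_exp c (Suc k) (a * x $ i + b)"
  have D: "(?f has_derivative (\<lambda>h. ?d x * (a * h $ i))) (at x)" for x
  proof -
    have "((\<lambda>x::R3. a * x $ i + b) has_derivative (\<lambda>h. a * h $ i)) (at x)"
      by (auto intro!: derivative_eq_intros bounded_linear_imp_has_derivative bounded_linear_vec_nth)
    from has_derivative_compose[OF this flat_exp_deriv[OF c, unfolded has_field_derivative_def]]
    show ?thesis by simp
  qed
  have "grad ?f x $ j = ?d x * (a * axis j 1 $ i)" for x j
    by (rule grad_eq[OF D])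
  moreover have "Ck n (\<lambda>x. ?d x * (a * axis j 1 $ i))" for j
    by (intro Ck_mult Ck_add Ck_const Suc.IH)
  moreover have "?f differentiable (at x)" for x
    using D[of x] unfolding differentiable_def by blast
  ultimately show ?case by simp
qed

text \<open>The parameter \<open>c\<close> is there to be sent to 0: every factor at a positive
  argument is then an exponential tending to 1, so the bumps approximate the indicator of the open
  box while remaining smooth.\<close>

definition bump :: "real \<Rightarrow> R3 \<Rightarrow> R3 \<Rightarrow> R3 \<Rightarrow> real" where
  "bump c a b x = (\<Prod>i\<in>UNIV. flat_exp c 0 (x $ i - a $ i) * flat_exp c 0 (b $ i - x $ i))"

lemma bump_nonzero: "bump c a b x \<noteq> 0 \<longleftrightarrow> x \<in> box a b"
  by (auto simp: bump_def flat_exp_def mem_box_cart)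

lemma test_function_bump:
  assumes "c > 0" "cbox a b \<subseteq> \<Omega>"
  shows "test_function \<Omega> (bump c a b)"
proof -
  have 1: "{x. bump c a b x \<noteq> 0} = box a b" by (simp add: bump_nonzero)
  have 2: "closure (box a b) \<subseteq> cbox a b" by (intro closure_minimal box_subset_cbox closed_cbox)
  have "Ck n (bump c a b)" for n
  proof -
    have "Ck n (\<lambda>x. flat_exp c 0 (1 * x $ i + (- a $ i)) * flat_exp c 0 ((-1) * x $ i + b $ i))" for i
      by (intro Ck_mult Ck_flat_exp assms)
    then show ?thesis unfolding bump_def by (intro Ck_prod) simp_all
  qed
  then show ?thesis
    unfolding test_function_def 1
    using 2 assms(2) bounded_subset[OF bounded_cbox 2] by (auto simp: compact_eq_bounded_closed)
qed

lemma bump_le_1: "c > 0 \<Longrightarrow> \<bar>bump c a b x\<bar> \<le> 1"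
  unfolding bump_def abs_prod
  by (intro prod_le_1) (auto simp: flat_exp_def abs_mult mult_le_one)

lemma bump_tendsto: "(\<lambda>n. bump (1 / real (Suc n)) a b x) \<longlonglongrightarrow> indicat_real (box a b) x"
proof (cases "x \<in> box a b")
  case True
  have *: "(\<lambda>n. flat_exp (1 / real (Suc n)) 0 t) \<longlonglongrightarrow> 1" if "t > 0" for t
  proof -
    have "(\<lambda>n. exp (- (inverse (real (Suc n))) / t)) \<longlonglongrightarrow> exp (- 0 / t)"
      using that by (intro tendsto_intros LIMSEQ_inverse_real_of_nat) auto
    then show ?thesis using that by (simp add: flat_exp_def inverse_eq_divide)
  qed
  have "(\<lambda>n. bump (1 / real (Suc n)) a b x) \<longlonglongrightarrow> (\<Prod>i\<in>(UNIV::3 set). 1 * 1)"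
    unfolding bump_def using True by (intro tendsto_prod tendsto_mult *) (auto simp: mem_box_cart)
  then show ?thesis using True by simp
next
  case False
  then have "bump c a b x = 0" for c using bump_nonzero by blast
  then show ?thesis using False by simp
qed

subsection \<open>Test functions\<close>

lemma test_function_continuous: "test_function \<Omega> \<phi> \<Longrightarrow> continuous_on UNIV \<phi>"
  unfolding test_function_def using Ck.simps(1) by blast

lemma test_function_zero: "test_function \<Omega> (\<lambda>x. 0)"
  by (simp add: test_function_def Ck_const)

text \<open>Off the closed support the function vanishes on an open set, hence so do its
  derivatives: differentiation does not enlarge the support.\<close>

lemma test_function_grad:
  assumes "test_function \<Omega> \<phi>"
  shows "test_function \<Omega> (\<lambda>x. grad \<phi> x $ i)"
proof -
  let ?K = "closure {x. \<phi> x \<noteq> 0}"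
  have "grad \<phi> x $ i = 0" if "x \<notin> ?K" for x
  proof -
    have "(\<phi> has_derivative (\<lambda>h. 0)) (at x)"
      by (rule has_derivative_transform_within_open[where f="\<lambda>x. 0" and s="- ?K"])
         (use that closure_subset[of "{x. \<phi> x \<noteq> 0}"] in auto)
    from grad_eq[OF this] show ?thesis .
  qed
  then have "{x. grad \<phi> x $ i \<noteq> 0} \<subseteq> ?K" by blast
  then have "closure {x. grad \<phi> x $ i \<noteq> 0} \<subseteq> ?K" by (intro closure_minimal) auto
  moreover have "Ck n (\<lambda>x. grad \<phi> x $ i)" for n
    using assms unfolding test_function_def by (metis Ck.simps(2))
  ultimately show ?thesis
    using assms unfolding test_function_def
    by (meson bounded_subset closed_closure compact_eq_bounded_closed subset_trans)
qed

lemma indicator_compact_L2: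
  fixes K :: "R3 set"
  assumes \<Omega>: "\<Omega> \<in> sets lebesgue" and K: "compact K"
  shows "indicat_real K \<in> L2 \<Omega>"
proof -
  have Km: "K \<in> sets lebesgue" using K by (simp add: lmeasurable_compact fmeasurableD)
  have meas: "indicat_real K \<in> borel_measurable (lebesgue_on \<Omega>)"
    using Km by (intro measurable_restrict_space1 borel_measurable_indicator)
  have "integrable lebesgue (indicat_real K)"
    using lmeasurable_compact[OF K] by (intro integrable_real_indicator) (auto simp: fmeasurable_def)
  then have "integrable lebesgue (\<lambda>x. indicator \<Omega> x *\<^sub>R indicat_real K x)"
    by (rule Bochner_Integration.integrable_bound) (use Km \<Omega> in \<open>auto simp: indicator_def\<close>)
  then have "integrable (lebesgue_on \<Omega>) (indicat_real K)"
    using \<Omega> by (subst integrable_restrict_space) auto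
  then show ?thesis
    by (rule L2I_bound[OF meas]) (auto simp: indicator_def)
qed

lemma test_function_L2:
  assumes \<Omega>: "\<Omega> \<in> sets lebesgue" and \<phi>: "test_function \<Omega>' \<phi>"
  shows "\<phi> \<in> L2 \<Omega>"
proof -
  let ?K = "closure {x. \<phi> x \<noteq> 0}"
  have K: "compact ?K" using \<phi> by (simp add: test_function_def)
  have "compact (\<phi> ` ?K)"
    using K test_function_continuous[OF \<phi>] by (intro compact_continuous_image) (auto intro: continuous_on_subset)
  then have "bounded (\<phi> ` ?K)" by (rule compact_imp_bounded)
  then obtain m where "\<forall>y\<in>\<phi> ` ?K. norm y \<le> m" unfolding bounded_iff by blast
  then have m: "\<bar>\<phi> x\<bar> \<le> m" if "x \<in> ?K" for x using that by simp
  have "\<phi> \<in> borel_measurable lebesgue"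
    using borel_measurable_continuous_onI[OF test_function_continuous[OF \<phi>]]
    by (simp add: measurable_completion)
  then have meas: "\<phi> \<in> borel_measurable (lebesgue_on \<Omega>)"
    by (rule measurable_restrict_space1)
  have int: "integrable (lebesgue_on \<Omega>) (\<lambda>x. m\<^sup>2 * (norm (indicat_real ?K x))\<^sup>2)"
    using L2_integrable_square[OF indicator_compact_L2[OF \<Omega> K]] by (rule integrable_mult_right)
  show ?thesis
  proof (rule L2I_bound[OF meas int])
    fix x
    show "(norm (\<phi> x))\<^sup>2 \<le> m\<^sup>2 * (norm (indicat_real ?K x))\<^sup>2"
    proof (cases "x \<in> ?K")
      case True
      then show ?thesis using power_mono[OF m[OF True], of 2] by simp
    next
      case False
      then have "\<phi> x = 0" using closure_subset[of "{x. \<phi> x \<noteq> 0}"] by auto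
      then show ?thesis by simp
    qed
  qed
qed

lemma test_function_grad_L2:
  "\<Omega> \<in> sets lebesgue \<Longrightarrow> test_function \<Omega>' \<phi> \<Longrightarrow> grad \<phi> \<in> L2 \<Omega>"
  by (intro vec_L2I test_function_L2 test_function_grad)

lemma test_field_L2:
  "\<Omega> \<in> sets lebesgue \<Longrightarrow> test_field \<Omega>' \<phi> \<Longrightarrow> \<phi> \<in> L2 \<Omega>"
  unfolding test_field_def by (intro vec_L2I) (blast intro: test_function_L2)

lemma curl_components:
  "curl \<phi> x $ 1 = grad (\<lambda>y. \<phi> y $ 3) x $ 2 - grad (\<lambda>y. \<phi> y $ 2) x $ 3"
  "curl \<phi> x $ 2 = grad (\<lambda>y. \<phi> y $ 1) x $ 3 - grad (\<lambda>y. \<phi> y $ 3) x $ 1"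
  "curl \<phi> x $ 3 = grad (\<lambda>y. \<phi> y $ 2) x $ 1 - grad (\<lambda>y. \<phi> y $ 1) x $ 2"
  by (simp_all add: curl_def Let_def)

lemma test_field_curl_L2:
  assumes "\<Omega> \<in> sets lebesgue" "test_field \<Omega>' \<phi>"
  shows "curl \<phi> \<in> L2 \<Omega>"
proof -
  have "(\<lambda>x. grad (\<lambda>y. \<phi> y $ j) x $ i) \<in> L2 \<Omega>" for i j
    using assms by (auto simp: test_field_def intro: test_function_L2 test_function_grad)
  then have "\<forall>i. (\<lambda>x. curl \<phi> x $ i) \<in> L2 \<Omega>"
    unfolding forall_3 curl_components by (intro conjI L2_diff) auto
  then show ?thesis by (intro vec_L2I) blast
qed

subsection \<open>The fundamental lemma of the calculus of variations\<close>

text \<open>Bumps on a box inside \<Omega> converge to its indicator with an integrable bound, so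
  \<open>G\<close> has integral 0 over every such box. Averages over cubes shrinking to a point
  converge to the value almost everywhere, by Lebesgue's differentiation theorem, and these averages
  are all 0.\<close>

lemma AE_zero_of_test_functions:
  fixes G :: "R3 \<Rightarrow> 'b::euclidean_space"
  assumes \<Omega>: "open \<Omega>" and G: "G \<in> L2 \<Omega>"
    and z: "\<And>\<phi>. test_function \<Omega> \<phi> \<Longrightarrow> (\<integral>x. \<phi> x *\<^sub>R G x \<partial>lebesgue_on \<Omega>) = 0"
  shows "AE x in lebesgue_on \<Omega>. G x = 0"
proof -
  let ?M = "lebesgue_on \<Omega>"
  have \<Omega>m: "\<Omega> \<in> sets lebesgue" using \<Omega> by simp
  define g where "g = (\<lambda>x. if x \<in> \<Omega> then G x else 0)"
  \<comment> \<open>The differentiation theorem is about gauge integrals over arbitrary boxes;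
    extending \<open>G\<close> by 0 makes it applicable, and this identity translates between the
    two integrals.\<close>
  have ind: "(g has_integral (\<integral>x. indicat_real (cbox a b) x *\<^sub>R G x \<partial>?M)) (cbox a b)" for a b
  proof -
    have "integrable ?M (\<lambda>x. indicat_real (cbox a b) x *\<^sub>R G x)"
      by (intro L2_scaleR_integrable indicator_compact_L2 \<Omega>m compact_cbox G)
    from has_integral_integral_lebesgue_on[OF this \<Omega>m]
    have "((\<lambda>x. if x \<in> \<Omega> then indicat_real (cbox a b) x *\<^sub>R G x else 0) has_integral
        (\<integral>x. indicat_real (cbox a b) x *\<^sub>R G x \<partial>?M)) UNIV"
      by (simp only: has_integral_restrict_UNIV)
    moreover have "(\<lambda>x. if x \<in> \<Omega> then indicat_real (cbox a b) x *\<^sub>R G x else 0)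
        = (\<lambda>x. if x \<in> cbox a b then g x else 0)"
      by (auto simp: g_def)
    ultimately show ?thesis by (simp only: has_integral_restrict_UNIV)
  qed
  have int0: "integral (cbox a b) g = 0" if ab: "cbox a b \<subseteq> \<Omega>" for a b
  proof -
    have "(\<lambda>n. \<integral>x. bump (1 / real (Suc n)) a b x *\<^sub>R G x \<partial>?M) \<longlonglongrightarrow> (\<integral>x. indicat_real (box a b) x *\<^sub>R G x \<partial>?M)"
    proof (rule integral_dominated_convergence)
      show "integrable ?M (\<lambda>x. norm (indicat_real (cbox a b) x *\<^sub>R G x))"
        by (intro integrable_norm L2_scaleR_integrable indicator_compact_L2 \<Omega>m compact_cbox G)
      have "indicat_real (box a b) \<in> borel_measurable ?M"
        by (intro measurable_restrict_space1 borel_measurable_indicator) simp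
      then show "(\<lambda>x. indicat_real (box a b) x *\<^sub>R G x) \<in> borel_measurable ?M"
        using L2_measurable[OF G] by (rule borel_measurable_scaleR)
      show "(\<lambda>x. bump (1 / real (Suc n)) a b x *\<^sub>R G x) \<in> borel_measurable ?M" for n
      proof -
        have "bump (1 / real (Suc n)) a b \<in> L2 \<Omega>"
          by (rule test_function_L2[OF \<Omega>m test_function_bump[OF _ ab]]) simp
        from L2_measurable[OF this] L2_measurable[OF G] show ?thesis
          by (rule borel_measurable_scaleR)
      qed
      show "AE x in ?M. (\<lambda>n. bump (1 / real (Suc n)) a b x *\<^sub>R G x) \<longlonglongrightarrow> indicat_real (box a b) x *\<^sub>R G x"
        by (intro AE_I2 tendsto_scaleR bump_tendsto tendsto_const)
      have "norm (bump (1 / real (Suc n)) a b x *\<^sub>R G x) \<le> norm (indicat_real (cbox a b) x *\<^sub>R G x)" for n x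
        using bump_le_1[of "1 / real (Suc n)" a b x] bump_nonzero[of "1 / real (Suc n)" a b x] box_subset_cbox[of a b]
        by (cases "x \<in> box a b") (auto simp: subset_iff intro!: mult_left_le_one_le)
      then show "AE x in ?M. norm (bump (1 / real (Suc n)) a b x *\<^sub>R G x) \<le> norm (indicat_real (cbox a b) x *\<^sub>R G x)" for n
        by simp
    qed
    moreover have "(\<integral>x. bump (1 / real (Suc n)) a b x *\<^sub>R G x \<partial>?M) = 0" for n
      by (intro z test_function_bump ab) simp
    ultimately have I: "(\<integral>x. indicat_real (box a b) x *\<^sub>R G x \<partial>?M) = 0"
      by (simp only: LIMSEQ_const_iff)
    \<comment> \<open>Bumps detect the open box, the differentiation theorem averages over closed
      ones; the faces have measure 0.\<close>
    have "negligible (cbox a b - box a b)"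
      by (rule negligible_frontier_interval)
    then have "AE x in lebesgue. x \<notin> cbox a b - box a b"
      by (intro AE_not_in) (simp only: negligible_iff_null_sets)
    then have "AE x in lebesgue. x \<in> \<Omega> \<longrightarrow> x \<notin> cbox a b - box a b"
      by (rule eventually_mono) blast
    then have AE: "AE x in ?M. x \<notin> cbox a b - box a b"
      using \<Omega>m by (subst AE_restrict_space_iff) auto
    have "(\<integral>x. indicat_real (cbox a b) x *\<^sub>R G x \<partial>?M) = (\<integral>x. indicat_real (box a b) x *\<^sub>R G x \<partial>?M)"
    proof (rule integral_cong_AE)
      have meas: "(\<lambda>x. indicat_real S x *\<^sub>R G x) \<in> borel_measurable ?M" if "S \<in> sets lebesgue" for S
        using that
        by (intro borel_measurable_scaleR measurable_restrict_space1 borel_measurable_indicator L2_measurable[OF G])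
      show "(\<lambda>x. indicat_real (cbox a b) x *\<^sub>R G x) \<in> borel_measurable ?M"
        "(\<lambda>x. indicat_real (box a b) x *\<^sub>R G x) \<in> borel_measurable ?M"
        by (rule meas, simp)+
      show "AE x in ?M. indicat_real (cbox a b) x *\<^sub>R G x = indicat_real (box a b) x *\<^sub>R G x"
        using AE
      proof (rule eventually_mono)
        fix x assume "x \<notin> cbox a b - box a b"
        then have "x \<in> cbox a b \<longleftrightarrow> x \<in> box a b" using box_subset_cbox[of a b] by blast
        then show "indicat_real (cbox a b) x *\<^sub>R G x = indicat_real (box a b) x *\<^sub>R G x"
          by (simp only: indicator_def)
      qed
    qed
    then show ?thesis using ind[of a b] I by (simp add: integral_unique)
  qed
  have gi: "g integrable_on cbox a b" for a b using ind by (rule has_integral_integrable)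
  obtain N where N: "negligible N"
    and lim: "\<forall>x e. x \<notin> N \<longrightarrow> 0 < e \<longrightarrow> (\<exists>d>0. \<forall>h. 0 < h \<and> h < d \<longrightarrow>
        norm (integral (cbox x (x + h *\<^sub>R One)) g /\<^sub>R h ^ DIM(R3) - g x) < e)"
  proof (rule integrable_ccontinuous_explicit[of g, OF gi])
    fix N
    assume "negligible N" and "\<And>x e. x \<notin> N \<Longrightarrow> 0 < e \<Longrightarrow> \<exists>d>0. \<forall>h. 0 < h \<and> h < d \<longrightarrow>
        norm (integral (cbox x (x + h *\<^sub>R One)) g /\<^sub>R h ^ DIM(R3) - g x) < e"
    then show thesis by (intro that[of N] allI impI)
  qed
  have zero: "G x = 0" if x: "x \<in> \<Omega>" "x \<notin> N" for x
  proof (rule ccontr)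
    assume "G x \<noteq> 0"
    \<comment> \<open>The size of \<open>G x\<close> itself serves as tolerance: a vanishing average
      within that distance of the value is a contradiction.\<close>
    then have e: "norm (G x) > 0" by simp
    obtain d where d: "d > 0" "\<And>h. 0 < h \<Longrightarrow> h < d \<Longrightarrow>
        norm (integral (cbox x (x + h *\<^sub>R One)) g /\<^sub>R h ^ DIM(R3) - g x) < norm (G x)"
      using lim[rule_format, OF x(2) e] by blast
    obtain r where r: "r > 0" "ball x r \<subseteq> \<Omega>" using \<Omega> x(1) open_contains_ball by blast
    have one: "norm (One::R3) > 0" by simp
    \<comment> \<open>The cube with corner \<open>x\<close> and side \<open>h\<close> has diameter
      \<open>h * norm One\<close>; the second bound keeps it in the ball, the halves make both
      inequalities strict.\<close>
    define h where "h = min (d / 2) (r / (2 * norm (One::R3)))"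
    have h: "h > 0" "h < d" "h * norm (One::R3) < r"
    proof -
      show "h > 0" "h < d" using d(1) r(1) one by (auto simp: h_def)
      have "h * norm (One::R3) \<le> r / (2 * norm (One::R3)) * norm (One::R3)"
        by (intro mult_right_mono) (auto simp: h_def)
      then show "h * norm (One::R3) < r" using one r(1) by simp
    qed
    have "cbox x (x + h *\<^sub>R One) \<subseteq> ball x r"
    proof
      fix y assume y: "y \<in> cbox x (x + h *\<^sub>R One)"
      have "norm (y - x) \<le> norm (h *\<^sub>R (One::R3))"
      proof (rule norm_le_componentwise)
        fix b :: R3 assume b: "b \<in> Basis"
        then have "x \<bullet> b \<le> y \<bullet> b" "y \<bullet> b \<le> (x + h *\<^sub>R One) \<bullet> b" using y by (auto simp: mem_box)
        then show "\<bar>(y - x) \<bullet> b\<bar> \<le> \<bar>h *\<^sub>R (One::R3) \<bullet> b\<bar>"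
          using h(1) by (simp add: inner_simps)
      qed
      also have "\<dots> < r" using h by simp
      finally show "y \<in> ball x r" by (simp add: dist_norm norm_minus_commute)
    qed
    then have "integral (cbox x (x + h *\<^sub>R One)) g = 0" using int0 r(2) by blast
    then have "norm (0 - g x) < norm (G x)" using d(2)[OF h(1,2)] by (simp only: scaleR_zero_right)
    then show False using x(1) by (simp add: g_def)
  qed
  have "AE x in lebesgue. x \<notin> N"
    using N by (intro AE_not_in) (simp only: negligible_iff_null_sets)
  then have "AE x in lebesgue. x \<in> \<Omega> \<longrightarrow> G x = 0"
    by (rule eventually_mono) (use zero in blast)
  then show ?thesis using \<Omega>m by (subst AE_restrict_space_iff) auto
qed

subsection \<open>Weak gradients\<close>

text \<open>The vector identity split into scalar L2 products, with both terms on one side: weak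
  differentiability becomes a family of orthogonality relations, linear in the pair of function and
  gradient.\<close>

lemma has_weak_grad_iff:
  assumes \<Omega>: "\<Omega> \<in> sets lebesgue" and u: "u \<in> L2 \<Omega>" and G: "G \<in> L2 \<Omega>"
  shows "has_weak_grad \<Omega> u G \<longleftrightarrow> (\<forall>\<phi> i. test_function \<Omega> \<phi> \<longrightarrow>
    L2_inner \<Omega> u (\<lambda>x. grad \<phi> x $ i) + L2_inner \<Omega> (\<lambda>x. G x $ i) \<phi> = 0)"
proof -
  have "(\<integral>x. u x *\<^sub>R grad \<phi> x \<partial>lebesgue_on \<Omega>) $ i = L2_inner \<Omega> u (\<lambda>x. grad \<phi> x $ i)"
    "(\<integral>x. \<phi> x *\<^sub>R G x \<partial>lebesgue_on \<Omega>) $ i = L2_inner \<Omega> (\<lambda>x. G x $ i) \<phi>"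
    if "test_function \<Omega> \<phi>" for \<phi> i
    using integral_bounded_linear[OF bounded_linear_vec_nth
        L2_scaleR_integrable[OF u test_function_grad_L2[OF \<Omega> that]], of i]
      integral_bounded_linear[OF bounded_linear_vec_nth
        L2_scaleR_integrable[OF test_function_L2[OF \<Omega> that] G], of i]
    by (simp_all add: L2_inner_def mult.commute)
  then show ?thesis
    unfolding has_weak_grad_def by (auto simp: vec_eq_iff eq_neg_iff_add_eq_0)
qed

lemma weak_grad:
  assumes "u \<in> H1 \<Omega>"
  shows "weak_grad \<Omega> u \<in> L2 \<Omega>" "has_weak_grad \<Omega> u (weak_grad \<Omega> u)"
proof -
  have "\<exists>G. G \<in> L2 \<Omega> \<and> has_weak_grad \<Omega> u G" using assms by (auto simp: H1_def)
  from someI_ex[OF this] show "weak_grad \<Omega> u \<in> L2 \<Omega>" "has_weak_grad \<Omega> u (weak_grad \<Omega> u)"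
    by (simp_all add: weak_grad_def)
qed

lemma has_weak_grad_lincomb:
  assumes \<Omega>: "\<Omega> \<in> sets lebesgue" and L: "u \<in> L2 \<Omega>" "v \<in> L2 \<Omega>" "G \<in> L2 \<Omega>" "H \<in> L2 \<Omega>"
    and "has_weak_grad \<Omega> u G" "has_weak_grad \<Omega> v H"
  shows "has_weak_grad \<Omega> (\<lambda>x. a * u x + c * v x) (\<lambda>x. a *\<^sub>R G x + c *\<^sub>R H x)"
proof -
  have L2': "(\<lambda>x. a * u x + c * v x) \<in> L2 \<Omega>" "(\<lambda>x. a *\<^sub>R G x + c *\<^sub>R H x) \<in> L2 \<Omega>"
    using L2_lincomb[OF L(1,2), of a c] L2_lincomb[OF L(3,4), of a c] by simp_all
  have "L2_inner \<Omega> (\<lambda>x. a * u x + c * v x) (\<lambda>x. grad \<phi> x $ i)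
      + L2_inner \<Omega> (\<lambda>x. (a *\<^sub>R G x + c *\<^sub>R H x) $ i) \<phi> = 0" if \<phi>: "test_function \<Omega> \<phi>" for \<phi> i
  proof -
    note t = test_function_L2[OF \<Omega> \<phi>] test_function_L2[OF \<Omega> test_function_grad[OF \<phi>], of i]
    have e: "L2_inner \<Omega> u (\<lambda>x. grad \<phi> x $ i) + L2_inner \<Omega> (\<lambda>x. G x $ i) \<phi> = 0"
      "L2_inner \<Omega> v (\<lambda>x. grad \<phi> x $ i) + L2_inner \<Omega> (\<lambda>x. H x $ i) \<phi> = 0"
      using assms(6,7) \<phi> by (simp_all add: has_weak_grad_iff \<Omega> L)
    have "L2_inner \<Omega> (\<lambda>x. a * u x + c * v x) (\<lambda>x. grad \<phi> x $ i)
      + L2_inner \<Omega> (\<lambda>x. (a *\<^sub>R G x + c *\<^sub>R H x) $ i) \<phi>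
      = a * (L2_inner \<Omega> u (\<lambda>x. grad \<phi> x $ i) + L2_inner \<Omega> (\<lambda>x. G x $ i) \<phi>)
      + c * (L2_inner \<Omega> v (\<lambda>x. grad \<phi> x $ i) + L2_inner \<Omega> (\<lambda>x. H x $ i) \<phi>)"
      using L2_inner_lincomb_left[OF L(1,2) t(2), of a c]
        L2_inner_lincomb_left[OF vec_L2D[OF L(3)] vec_L2D[OF L(4)] t(1), of a i c i]
      by (simp add: algebra_simps)
    then show ?thesis unfolding e by simp
  qed
  then show ?thesis by (simp only: has_weak_grad_iff[OF \<Omega> L2']) blast
qed

text \<open>Letting \<open>u\<close> and \<open>u'\<close> differ on a null set gives at once
  independence of the chosen gradient and of the representative of the function.\<close>

lemma has_weak_grad_unique:
  assumes \<Omega>: "open \<Omega>" and L: "u \<in> L2 \<Omega>" "u' \<in> L2 \<Omega>" "G \<in> L2 \<Omega>" "G' \<in> L2 \<Omega>"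
    and "ae_eq \<Omega> u u'" "has_weak_grad \<Omega> u G" "has_weak_grad \<Omega> u' G'"
  shows "ae_eq \<Omega> G G'"
proof -
  have \<Omega>m: "\<Omega> \<in> sets lebesgue" using \<Omega> by simp
  have "AE x in lebesgue_on \<Omega>. G x - G' x = 0"
  proof (rule AE_zero_of_test_functions[OF \<Omega> L2_diff[OF L(3,4)]])
    fix \<phi> assume \<phi>: "test_function \<Omega> \<phi>"
    have "(\<integral>x. u x *\<^sub>R grad \<phi> x \<partial>lebesgue_on \<Omega>) = (\<integral>x. u' x *\<^sub>R grad \<phi> x \<partial>lebesgue_on \<Omega>)"
    proof (rule integral_cong_AE)
      show "AE x in lebesgue_on \<Omega>. u x *\<^sub>R grad \<phi> x = u' x *\<^sub>R grad \<phi> x"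
        using assms(6) unfolding ae_eq_def by eventually_elim simp
    qed (rule borel_measurable_scaleR L2_measurable L test_function_grad_L2[OF \<Omega>m \<phi>])+
    then have "(\<integral>x. \<phi> x *\<^sub>R G x \<partial>lebesgue_on \<Omega>) = (\<integral>x. \<phi> x *\<^sub>R G' x \<partial>lebesgue_on \<Omega>)"
      using assms(7,8)[unfolded has_weak_grad_def, rule_format, OF \<phi>] by simp
    then show "(\<integral>x. \<phi> x *\<^sub>R (G x - G' x) \<partial>lebesgue_on \<Omega>) = 0"
      using L2_scaleR_integrable[OF test_function_L2[OF \<Omega>m \<phi>] L(3)]
        L2_scaleR_integrable[OF test_function_L2[OF \<Omega>m \<phi>] L(4)]
      by (simp add: scaleR_right_diff_distrib)
  qed
  then show ?thesis by (simp add: ae_eq_def)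
qed

text \<open>The gradient chosen for the zero function is known to vanish only almost everywhere, so
  uniqueness of weak gradients is invoked even here.\<close>

lemma H1_norm_zero: "open \<Omega> \<Longrightarrow> (\<lambda>x. 0) \<in> H1 \<Omega> \<and> H1_norm \<Omega> (\<lambda>x. 0) = 0"
proof -
  assume \<Omega>: "open \<Omega>"
  have w: "has_weak_grad \<Omega> (\<lambda>x. 0) (\<lambda>x. 0)" by (simp add: has_weak_grad_def)
  then have z: "(\<lambda>x. 0) \<in> H1 \<Omega>"
    unfolding H1_def by (intro CollectI conjI bexI[of _ "\<lambda>x. 0"] L2_zero)
  have "ae_eq \<Omega> (weak_grad \<Omega> (\<lambda>x. 0)) (\<lambda>x. 0)"
    by (rule has_weak_grad_unique[OF \<Omega> L2_zero L2_zero weak_grad(1)[OF z] L2_zero _ weak_grad(2)[OF z] w])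
       (simp add: ae_eq_def)
  then have "L2_inner \<Omega> (weak_grad \<Omega> (\<lambda>x. 0)) (weak_grad \<Omega> (\<lambda>x. 0)) = L2_inner \<Omega> (\<lambda>x. 0::R3) (\<lambda>x. 0)"
    by (intro L2_inner_cong_AE weak_grad z L2_zero)
  then show ?thesis using z by (simp add: H1_norm_def H1_inner_def L2_inner_def)
qed

text \<open>This amounts to the empty set having capacity 0, with the zero function and the empty
  neighbourhood as competitor. It makes \<open>Trv \<Omega> v\<close> a representative of its own
  boundary class.\<close>

lemma qe_eq_refl: "qe_eq \<Omega> f f"
proof -
  have "capacity {} \<le> ennreal ((H1_norm UNIV (\<lambda>x. 0))\<^sup>2)"
    unfolding capacity_def
    by (rule INF_lower) (use H1_norm_zero[of UNIV] in \<open>auto intro!: exI[of _ "{}"] AE_I2\<close>)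
  then show ?thesis using H1_norm_zero[of UNIV] by (simp add: qe_eq_def)
qed

subsection \<open>Jacobians of vector fields\<close>

text \<open>Row \<open>j\<close> is the gradient of component \<open>j\<close>, so
  \<open>G x $ j $ i\<close> is the partial derivative of component \<open>j\<close> in direction
  \<open>i\<close>. A relation lets computations use any Jacobian at hand rather than the chosen
  one.\<close>

definition has_weak_jac :: "R3 set \<Rightarrow> (R3 \<Rightarrow> R3) \<Rightarrow> (R3 \<Rightarrow> real^3^3) \<Rightarrow> bool" where
  "has_weak_jac \<Omega> u G \<longleftrightarrow> (\<forall>j. has_weak_grad \<Omega> (\<lambda>x. u x $ j) (\<lambda>x. G x $ j))"

definition weak_jac :: "R3 set \<Rightarrow> (R3 \<Rightarrow> R3) \<Rightarrow> R3 \<Rightarrow> real^3^3" where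
  "weak_jac \<Omega> u x = (\<chi> j. weak_grad \<Omega> (\<lambda>y. u y $ j) x)"

lemma H1v_L2: "u \<in> H1v \<Omega> \<Longrightarrow> u \<in> L2 \<Omega>"
  by (intro vec_L2I) (simp add: H1v_def H1_def)

lemma weak_jac:
  assumes "u \<in> H1v \<Omega>"
  shows "weak_jac \<Omega> u \<in> L2 \<Omega>" "has_weak_jac \<Omega> u (weak_jac \<Omega> u)"
proof -
  have "(\<lambda>x. u x $ j) \<in> H1 \<Omega>" for j using assms by (simp add: H1v_def)
  note w = weak_grad[OF this]
  show "weak_jac \<Omega> u \<in> L2 \<Omega>" by (rule vec_L2I) (simp add: weak_jac_def w)
  show "has_weak_jac \<Omega> u (weak_jac \<Omega> u)" by (simp add: has_weak_jac_def weak_jac_def w)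
qed

lemma H1vI: "u \<in> L2 \<Omega> \<Longrightarrow> G \<in> L2 \<Omega> \<Longrightarrow> has_weak_jac \<Omega> u G \<Longrightarrow> u \<in> H1v \<Omega>"
  unfolding H1v_def H1_def has_weak_jac_def by (blast intro: vec_L2D)

lemma has_weak_jac_lincomb:
  assumes "\<Omega> \<in> sets lebesgue" "u \<in> L2 \<Omega>" "v \<in> L2 \<Omega>" "G \<in> L2 \<Omega>" "H \<in> L2 \<Omega>"
    and "has_weak_jac \<Omega> u G" "has_weak_jac \<Omega> v H"
  shows "has_weak_jac \<Omega> (\<lambda>x. a *\<^sub>R u x + c *\<^sub>R v x) (\<lambda>x. a *\<^sub>R G x + c *\<^sub>R H x)"
  unfolding has_weak_jac_def
proof
  fix j
  show "has_weak_grad \<Omega> (\<lambda>x. (a *\<^sub>R u x + c *\<^sub>R v x) $ j) (\<lambda>x. (a *\<^sub>R G x + c *\<^sub>R H x) $ j)"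
    using has_weak_grad_lincomb[OF assms(1) vec_L2D[OF assms(2)] vec_L2D[OF assms(3)] vec_L2D[OF assms(4)]
        vec_L2D[OF assms(5)], of j j j j a c] assms(6,7)
    by (simp add: has_weak_jac_def)
qed

lemma has_weak_jac_unique:
  assumes "open \<Omega>" "u \<in> L2 \<Omega>" "u' \<in> L2 \<Omega>" "G \<in> L2 \<Omega>" "G' \<in> L2 \<Omega>"
    and "ae_eq \<Omega> u u'" "has_weak_jac \<Omega> u G" "has_weak_jac \<Omega> u' G'"
  shows "ae_eq \<Omega> G G'"
proof -
  have "ae_eq \<Omega> (\<lambda>x. G x $ j) (\<lambda>x. G' x $ j)" for j
  proof (rule has_weak_grad_unique[OF assms(1)])
    show "ae_eq \<Omega> (\<lambda>x. u x $ j) (\<lambda>x. u' x $ j)"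
      using assms(6) unfolding ae_eq_def by eventually_elim simp
  qed (use assms in \<open>auto intro: vec_L2D simp: has_weak_jac_def\<close>)
  then have "AE x in lebesgue_on \<Omega>. \<forall>j. G x $ j = G' x $ j"
    unfolding ae_eq_def by (simp add: AE_all_countable)
  then show ?thesis by (simp add: ae_eq_def vec_eq_iff)
qed

lemma H1v_lincomb:
  assumes "open \<Omega>" "u \<in> H1v \<Omega>" "v \<in> H1v \<Omega>"
  shows "(\<lambda>x. a *\<^sub>R u x + c *\<^sub>R v x) \<in> H1v \<Omega>"
proof (rule H1vI)
  have \<Omega>: "\<Omega> \<in> sets lebesgue" using assms(1) by simp
  show "(\<lambda>x. a *\<^sub>R u x + c *\<^sub>R v x) \<in> L2 \<Omega>"
    "(\<lambda>x. a *\<^sub>R weak_jac \<Omega> u x + c *\<^sub>R weak_jac \<Omega> v x) \<in> L2 \<Omega>"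
    by (intro L2_lincomb H1v_L2 weak_jac assms)+
  show "has_weak_jac \<Omega> (\<lambda>x. a *\<^sub>R u x + c *\<^sub>R v x) (\<lambda>x. a *\<^sub>R weak_jac \<Omega> u x + c *\<^sub>R weak_jac \<Omega> v x)"
    by (intro has_weak_jac_lincomb \<Omega> H1v_L2 weak_jac assms)
qed

lemma H1v_diff: "open \<Omega> \<Longrightarrow> u \<in> H1v \<Omega> \<Longrightarrow> v \<in> H1v \<Omega> \<Longrightarrow> (\<lambda>x. u x - v x) \<in> H1v \<Omega>"
  using H1v_lincomb[of \<Omega> u v 1 "-1"] by simp

lemma L2_inner_vec:
  fixes f g :: "R3 \<Rightarrow> 'b::euclidean_space^'n"
  assumes "f \<in> L2 \<Omega>" "g \<in> L2 \<Omega>"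
  shows "L2_inner \<Omega> f g = (\<Sum>i\<in>UNIV. L2_inner \<Omega> (\<lambda>x. f x $ i) (\<lambda>x. g x $ i))"
  using L2_inner_integrable[OF vec_L2D[OF assms(1)] vec_L2D[OF assms(2)]]
  by (simp add: L2_inner_def inner_vec_def)

lemma H1v_inner_eq_weak_jac:
  assumes "u \<in> H1v \<Omega>" "v \<in> H1v \<Omega>"
  shows "H1v_inner \<Omega> u v = L2_inner \<Omega> u v + L2_inner \<Omega> (weak_jac \<Omega> u) (weak_jac \<Omega> v)"
  unfolding L2_inner_vec[OF H1v_L2[OF assms(1)] H1v_L2[OF assms(2)]]
    L2_inner_vec[OF weak_jac(1)[OF assms(1)] weak_jac(1)[OF assms(2)]]
  by (simp add: H1v_inner_def H1_inner_def L2_inner_def weak_jac_def sum.distrib)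

text \<open>Any weak Jacobians may replace the chosen ones, which are inaccessible for sums and
  differences of fields.\<close>

lemma H1v_inner_eq:
  assumes \<Omega>: "open \<Omega>" and L: "u \<in> L2 \<Omega>" "v \<in> L2 \<Omega>" "G \<in> L2 \<Omega>" "H \<in> L2 \<Omega>"
    and j: "has_weak_jac \<Omega> u G" "has_weak_jac \<Omega> v H"
  shows "H1v_inner \<Omega> u v = L2_inner \<Omega> u v + L2_inner \<Omega> G H"
proof -
  have u: "u \<in> H1v \<Omega>" and v: "v \<in> H1v \<Omega>" using L j H1vI by blast+
  have "L2_inner \<Omega> (weak_jac \<Omega> u) (weak_jac \<Omega> v) = L2_inner \<Omega> G H"
    by (intro L2_inner_cong_AE has_weak_jac_unique[OF \<Omega> L(1) L(1)] has_weak_jac_unique[OF \<Omega> L(2) L(2)]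
        weak_jac u v L j) (simp_all add: ae_eq_def)
  then show ?thesis using H1v_inner_eq_weak_jac[OF u v] by simp
qed

lemma H1v_inner_commute: "H1v_inner \<Omega> u v = H1v_inner \<Omega> v u"
  by (simp add: H1v_inner_def H1_inner_def inner_commute mult.commute)

lemma H1v_inner_lincomb_left:
  assumes \<Omega>: "open \<Omega>" and H: "u \<in> H1v \<Omega>" "v \<in> H1v \<Omega>" "w \<in> H1v \<Omega>"
  shows "H1v_inner \<Omega> (\<lambda>x. a *\<^sub>R u x + c *\<^sub>R v x) w = a * H1v_inner \<Omega> u w + c * H1v_inner \<Omega> v w"
proof -
  have \<Omega>m: "\<Omega> \<in> sets lebesgue" using \<Omega> by simp
  note L = H1v_L2[OF H(1)] H1v_L2[OF H(2)] H1v_L2[OF H(3)]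
    weak_jac(1)[OF H(1)] weak_jac(1)[OF H(2)] weak_jac(1)[OF H(3)]
  note j = weak_jac(2)[OF H(1)] weak_jac(2)[OF H(2)] weak_jac(2)[OF H(3)]
  have "H1v_inner \<Omega> (\<lambda>x. a *\<^sub>R u x + c *\<^sub>R v x) w = L2_inner \<Omega> (\<lambda>x. a *\<^sub>R u x + c *\<^sub>R v x) w
    + L2_inner \<Omega> (\<lambda>x. a *\<^sub>R weak_jac \<Omega> u x + c *\<^sub>R weak_jac \<Omega> v x) (weak_jac \<Omega> w)"
    by (intro H1v_inner_eq[OF \<Omega>] L2_lincomb has_weak_jac_lincomb \<Omega>m L j)
  then show ?thesis
    unfolding H1v_inner_eq_weak_jac[OF H(1,3)] H1v_inner_eq_weak_jac[OF H(2,3)]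
      L2_inner_lincomb_left[OF L(1,2,3)] L2_inner_lincomb_left[OF L(4,5,6)]
    by (simp add: algebra_simps)
qed

lemma H1v_inner_self_add:
  assumes \<Omega>: "open \<Omega>" and u: "u \<in> H1v \<Omega>" and v: "v \<in> H1v \<Omega>"
  shows "H1v_inner \<Omega> (\<lambda>x. u x + v x) (\<lambda>x. u x + v x)
    = H1v_inner \<Omega> u u + 2 * H1v_inner \<Omega> u v + H1v_inner \<Omega> v v"
proof -
  let ?s = "\<lambda>x. u x + v x"
  have s: "?s \<in> H1v \<Omega>" using H1v_lincomb[OF assms, of 1 1] by simp
  have add: "H1v_inner \<Omega> ?s z = H1v_inner \<Omega> u z + H1v_inner \<Omega> v z" if "z \<in> H1v \<Omega>" for z
    using H1v_inner_lincomb_left[OF assms that, of 1 1] by simp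
  show ?thesis
    unfolding add[OF s] H1v_inner_commute[of \<Omega> u ?s] H1v_inner_commute[of \<Omega> v ?s] add[OF u] add[OF v]
      H1v_inner_commute[of \<Omega> v u]
    by simp
qed

lemma H1v_inner_self: "u \<in> H1v \<Omega> \<Longrightarrow> H1v_inner \<Omega> u u = (L2_norm \<Omega> u)\<^sup>2 + (L2_norm \<Omega> (weak_jac \<Omega> u))\<^sup>2"
  by (simp add: H1v_inner_eq_weak_jac L2_inner_self)

lemma H1v_inner_self_nonneg: "u \<in> H1v \<Omega> \<Longrightarrow> 0 \<le> H1v_inner \<Omega> u u"
  by (simp add: H1v_inner_self)

lemma H1v_inner_self_eq_0:
  assumes "u \<in> H1v \<Omega>" "H1v_inner \<Omega> u u = 0"
  shows "AE x in lebesgue_on \<Omega>. u x = 0"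
proof (rule L2_inner_self_eq_0[OF H1v_L2[OF assms(1)]])
  show "L2_inner \<Omega> u u = 0"
    using assms(2) unfolding H1v_inner_self[OF assms(1)] L2_inner_self
    by (simp add: sum_power2_eq_zero_iff)
qed

subsection \<open>Weak curls\<close>

text \<open>Isolating the pointwise algebra as a linear map on matrices makes its adjoint available
  as well, which is needed to state orthogonality relations for the Jacobian.\<close>

definition curl_of_jac :: "real^3^3 \<Rightarrow> R3" where
  "curl_of_jac G = vector [G $ 3 $ 2 - G $ 2 $ 3, G $ 1 $ 3 - G $ 3 $ 1, G $ 2 $ 1 - G $ 1 $ 2]"

lemma linear_curl_of_jac: "linear curl_of_jac"
  by (rule linearI) (simp_all add: curl_of_jac_def vec_eq_iff forall_3 algebra_simps)

lemma bounded_linear_curl_of_jac: "bounded_linear curl_of_jac"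
  using linear_curl_of_jac by (simp add: linear_conv_bounded_linear)

text \<open>Each pair of mirrored entries satisfies (a - b)^2 + (a + b)^2 = 2 a^2 + 2 b^2. Equality
  holds for antisymmetric matrices, so 2 is the best pointwise constant.\<close>

lemma norm_curl_of_jac: "(norm (curl_of_jac G))\<^sup>2 \<le> 2 * (norm G)\<^sup>2"
proof -
  have "2 * (norm G)\<^sup>2 - (norm (curl_of_jac G))\<^sup>2
      = (G $ 3 $ 2 + G $ 2 $ 3)\<^sup>2 + (G $ 1 $ 3 + G $ 3 $ 1)\<^sup>2 + (G $ 2 $ 1 + G $ 1 $ 2)\<^sup>2
        + 2 * ((G $ 1 $ 1)\<^sup>2 + (G $ 2 $ 2)\<^sup>2 + (G $ 3 $ 3)\<^sup>2)"
    unfolding power2_norm_eq_inner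
    by (simp add: inner_vec_def sum_3 curl_of_jac_def power2_eq_square algebra_simps)
  also have "\<dots> \<ge> 0" by simp
  finally show ?thesis by simp
qed

text \<open>Expanding the product with the curl of the test field gives six terms, each moved onto
  \<open>w\<close> by a weak gradient identity. The six minus signs are absorbed by the antisymmetry
  of the curl.\<close>

lemma has_weak_curl_of_jac:
  assumes \<Omega>: "\<Omega> \<in> sets lebesgue" and w: "w \<in> L2 \<Omega>" and G: "G \<in> L2 \<Omega>" and j: "has_weak_jac \<Omega> w G"
  shows "has_weak_curl \<Omega> w (\<lambda>x. curl_of_jac (G x))"
  unfolding has_weak_curl_def
proof (intro allI impI)
  fix \<phi> assume \<phi>: "test_field \<Omega> \<phi>"
  let ?M = "lebesgue_on \<Omega>"
  let ?d = "\<lambda>k i x. grad (\<lambda>y. \<phi> y $ k) x $ i"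
  have t: "test_function \<Omega> (\<lambda>y. \<phi> y $ k)" for k using \<phi> by (simp add: test_field_def)
  have i1: "integrable ?M (\<lambda>x. w x $ j * ?d k i x)" for i j k
    by (intro L2_mult_integrable vec_L2D w test_function_L2[OF \<Omega> test_function_grad[OF t]])
  have Gji: "(\<lambda>x. G x $ j $ i) \<in> L2 \<Omega>" for i j
    by (intro vec_L2D G)
  have i2: "integrable ?M (\<lambda>x. G x $ j $ i * \<phi> x $ k)" for i j k
    by (intro L2_mult_integrable Gji test_function_L2[OF \<Omega> t])
  have e: "(\<integral>x. w x $ j * ?d k i x \<partial>?M) = - (\<integral>x. G x $ j $ i * \<phi> x $ k \<partial>?M)" for i j k
    using j[unfolded has_weak_jac_def, rule_format, of j] t[of k]
    unfolding has_weak_grad_iff[OF \<Omega> vec_L2D[OF w] vec_L2D[OF G]] L2_inner_def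
    by (simp add: eq_neg_iff_add_eq_0)
  have "(\<integral>x. w x \<bullet> curl \<phi> x \<partial>?M) = (\<integral>x. (w x $ 1 * ?d 3 2 x - w x $ 1 * ?d 2 3 x)
      + (w x $ 2 * ?d 1 3 x - w x $ 2 * ?d 3 1 x) + (w x $ 3 * ?d 2 1 x - w x $ 3 * ?d 1 2 x) \<partial>?M)"
    by (rule Bochner_Integration.integral_cong)
       (simp_all add: inner_vec_def sum_3 curl_components algebra_simps)
  also have "\<dots> = (\<integral>x. (G x $ 3 $ 2 * \<phi> x $ 1 - G x $ 2 $ 3 * \<phi> x $ 1)
      + (G x $ 1 $ 3 * \<phi> x $ 2 - G x $ 3 $ 1 * \<phi> x $ 2) + (G x $ 2 $ 1 * \<phi> x $ 3 - G x $ 1 $ 2 * \<phi> x $ 3) \<partial>?M)"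
    by (simp add: i1 i2 e)
  also have "\<dots> = (\<integral>x. curl_of_jac (G x) \<bullet> \<phi> x \<partial>?M)"
    by (rule Bochner_Integration.integral_cong)
       (simp_all add: inner_vec_def sum_3 curl_of_jac_def algebra_simps)
  finally show "(\<integral>x. w x \<bullet> curl \<phi> x \<partial>?M) = (\<integral>x. curl_of_jac (G x) \<bullet> \<phi> x \<partial>?M)" .
qed

lemma Hcurl_L2: "w \<in> Hcurl \<Omega> \<Longrightarrow> w \<in> L2 \<Omega>"
  by (simp add: Hcurl_def)

lemma weak_curl:
  assumes "w \<in> Hcurl \<Omega>"
  shows "weak_curl \<Omega> w \<in> L2 \<Omega>" "has_weak_curl \<Omega> w (weak_curl \<Omega> w)"
proof -
  have "\<exists>c. c \<in> L2 \<Omega> \<and> has_weak_curl \<Omega> w c" using assms by (auto simp: Hcurl_def)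
  from someI_ex[OF this] show "weak_curl \<Omega> w \<in> L2 \<Omega>" "has_weak_curl \<Omega> w (weak_curl \<Omega> w)"
    by (simp_all add: weak_curl_def)
qed

lemma HcurlI: "w \<in> L2 \<Omega> \<Longrightarrow> c \<in> L2 \<Omega> \<Longrightarrow> has_weak_curl \<Omega> w c \<Longrightarrow> w \<in> Hcurl \<Omega>"
  by (auto simp: Hcurl_def)

lemma H1v_subset_Hcurl:
  assumes "\<Omega> \<in> sets lebesgue"
  shows "H1v \<Omega> \<subseteq> Hcurl \<Omega>"
proof
  fix u assume u: "u \<in> H1v \<Omega>"
  show "u \<in> Hcurl \<Omega>"
    by (rule HcurlI[OF H1v_L2[OF u] L2_bounded_linear[OF bounded_linear_curl_of_jac weak_jac(1)[OF u]]
          has_weak_curl_of_jac[OF assms H1v_L2[OF u] weak_jac[OF u]]])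
qed

lemma has_weak_curl_iff:
  "has_weak_curl \<Omega> w c \<longleftrightarrow> (\<forall>\<phi>. test_field \<Omega> \<phi> \<longrightarrow> L2_inner \<Omega> w (curl \<phi>) = L2_inner \<Omega> c \<phi>)"
  by (simp add: has_weak_curl_def L2_inner_def)

lemma has_weak_curl_lincomb:
  assumes \<Omega>: "\<Omega> \<in> sets lebesgue" and L: "u \<in> L2 \<Omega>" "v \<in> L2 \<Omega>" "c \<in> L2 \<Omega>" "d \<in> L2 \<Omega>"
    and "has_weak_curl \<Omega> u c" "has_weak_curl \<Omega> v d"
  shows "has_weak_curl \<Omega> (\<lambda>x. a *\<^sub>R u x + b *\<^sub>R v x) (\<lambda>x. a *\<^sub>R c x + b *\<^sub>R d x)"
  using assms(6,7) unfolding has_weak_curl_iff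
  by (simp add: L2_inner_lincomb_left[OF L(1,2) test_field_curl_L2[OF \<Omega>]]
      L2_inner_lincomb_left[OF L(3,4) test_field_L2[OF \<Omega>]])

lemma has_weak_curl_unique:
  assumes \<Omega>: "open \<Omega>" and L: "u \<in> L2 \<Omega>" "u' \<in> L2 \<Omega>" "c \<in> L2 \<Omega>" "c' \<in> L2 \<Omega>"
    and "ae_eq \<Omega> u u'" "has_weak_curl \<Omega> u c" "has_weak_curl \<Omega> u' c'"
  shows "ae_eq \<Omega> c c'"
proof -
  have \<Omega>m: "\<Omega> \<in> sets lebesgue" using \<Omega> by simp
  have "AE x in lebesgue_on \<Omega>. c x - c' x = 0"
  proof (rule AE_zero_of_test_functions[OF \<Omega> L2_diff[OF L(3,4)]])
    fix \<phi> assume \<phi>: "test_function \<Omega> \<phi>"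
    have "(\<integral>x. \<phi> x *\<^sub>R (c x - c' x) \<partial>lebesgue_on \<Omega>) $ i = 0" for i
    proof -
      \<comment> \<open>A test field with a single nonzero component isolates component
        \<open>i\<close> of the difference.\<close>
      let ?f = "\<lambda>x. axis i (\<phi> x) :: R3"
      have f: "test_field \<Omega> ?f"
        unfolding test_field_def
      proof
        fix j
        show "test_function \<Omega> (\<lambda>x. ?f x $ j)"
          using \<phi> test_function_zero by (cases "i = j") (auto simp: axis_def)
      qed
      have "L2_inner \<Omega> u (curl ?f) = L2_inner \<Omega> u' (curl ?f)"
        by (intro L2_inner_cong_AE L test_field_curl_L2[OF \<Omega>m f] assms(6)) (simp add: ae_eq_def)
      then have "L2_inner \<Omega> (\<lambda>x. c x - c' x) ?f = 0"
        using assms(7,8) f by (simp add: has_weak_curl_iff L2_inner_diff_left L test_field_L2[OF \<Omega>m f])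
      moreover have "(\<integral>x. \<phi> x *\<^sub>R (c x - c' x) \<partial>lebesgue_on \<Omega>) $ i = L2_inner \<Omega> (\<lambda>x. c x - c' x) ?f"
        using integral_bounded_linear[OF bounded_linear_vec_nth
            L2_scaleR_integrable[OF test_function_L2[OF \<Omega>m \<phi>] L2_diff[OF L(3,4)]], of i]
        by (simp add: L2_inner_def inner_axis mult.commute)
      ultimately show ?thesis by simp
    qed
    then show "(\<integral>x. \<phi> x *\<^sub>R (c x - c' x) \<partial>lebesgue_on \<Omega>) = 0" by (simp add: vec_eq_iff)
  qed
  then show ?thesis by (simp add: ae_eq_def)
qed

lemma Hcurl_lincomb:
  assumes "\<Omega> \<in> sets lebesgue" "u \<in> Hcurl \<Omega>" "v \<in> Hcurl \<Omega>"
  shows "(\<lambda>x. a *\<^sub>R u x + c *\<^sub>R v x) \<in> Hcurl \<Omega>"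
  by (rule HcurlI[OF L2_lincomb[OF Hcurl_L2 Hcurl_L2] L2_lincomb[OF weak_curl(1) weak_curl(1)]
        has_weak_curl_lincomb[OF assms(1) Hcurl_L2 Hcurl_L2 weak_curl(1) weak_curl(1) weak_curl(2) weak_curl(2)]])
     (rule assms)+

subsection \<open>The Stokes form\<close>

lemma stokes_form_eq_weak_curl:
  assumes "u \<in> Hcurl \<Omega>" "v \<in> Hcurl \<Omega>"
  shows "stokes_form \<Omega> u v = L2_inner \<Omega> u (weak_curl \<Omega> v) - L2_inner \<Omega> v (weak_curl \<Omega> u)"
  using L2_inner_integrable[OF Hcurl_L2[OF assms(1)] weak_curl(1)[OF assms(2)]]
    L2_inner_integrable[OF Hcurl_L2[OF assms(2)] weak_curl(1)[OF assms(1)]]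
  by (simp add: stokes_form_def L2_inner_def)

text \<open>Representatives and curls may be replaced simultaneously. Linearity and independence of
  all choices follow by supplying suitable curls.\<close>

lemma stokes_form_eq:
  assumes \<Omega>: "open \<Omega>" and uv: "u \<in> Hcurl \<Omega>" "v \<in> Hcurl \<Omega>"
    and L: "u' \<in> L2 \<Omega>" "v' \<in> L2 \<Omega>" "c \<in> L2 \<Omega>" "d \<in> L2 \<Omega>"
    and w: "has_weak_curl \<Omega> u' c" "has_weak_curl \<Omega> v' d" and ae: "ae_eq \<Omega> u u'" "ae_eq \<Omega> v v'"
  shows "stokes_form \<Omega> u v = L2_inner \<Omega> u' d - L2_inner \<Omega> v' c"
proof -
  have c: "ae_eq \<Omega> (weak_curl \<Omega> u) c"
    by (rule has_weak_curl_unique[OF \<Omega> Hcurl_L2[OF uv(1)] L(1) weak_curl(1)[OF uv(1)] L(3) ae(1)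
          weak_curl(2)[OF uv(1)] w(1)])
  have d: "ae_eq \<Omega> (weak_curl \<Omega> v) d"
    by (rule has_weak_curl_unique[OF \<Omega> Hcurl_L2[OF uv(2)] L(2) weak_curl(1)[OF uv(2)] L(4) ae(2)
          weak_curl(2)[OF uv(2)] w(2)])
  have "L2_inner \<Omega> u (weak_curl \<Omega> v) = L2_inner \<Omega> u' d" "L2_inner \<Omega> v (weak_curl \<Omega> u) = L2_inner \<Omega> v' c"
    by (rule L2_inner_cong_AE; (rule Hcurl_L2 weak_curl uv L ae c d)+)+
  then show ?thesis by (simp add: stokes_form_eq_weak_curl uv)
qed

lemma stokes_form_cong_AE:
  assumes "open \<Omega>" "u \<in> Hcurl \<Omega>" "u' \<in> Hcurl \<Omega>" "v \<in> Hcurl \<Omega>" "v' \<in> Hcurl \<Omega>"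
    and "ae_eq \<Omega> u u'" "ae_eq \<Omega> v v'"
  shows "stokes_form \<Omega> u v = stokes_form \<Omega> u' v'"
  unfolding stokes_form_eq_weak_curl[OF assms(3,5)]
  by (rule stokes_form_eq) (use assms in \<open>auto intro: Hcurl_L2 weak_curl\<close>)

lemma stokes_form_antisym:
  "u \<in> Hcurl \<Omega> \<Longrightarrow> v \<in> Hcurl \<Omega> \<Longrightarrow> stokes_form \<Omega> u v = - stokes_form \<Omega> v u"
  by (simp add: stokes_form_eq_weak_curl)

lemma stokes_form_lincomb_left:
  assumes \<Omega>: "open \<Omega>" and H: "u \<in> Hcurl \<Omega>" "v \<in> Hcurl \<Omega>" "w \<in> Hcurl \<Omega>"
  shows "stokes_form \<Omega> (\<lambda>x. a *\<^sub>R u x + c *\<^sub>R v x) w = a * stokes_form \<Omega> u w + c * stokes_form \<Omega> v w"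
proof -
  have \<Omega>m: "\<Omega> \<in> sets lebesgue" using \<Omega> by simp
  note L = Hcurl_L2[OF H(1)] Hcurl_L2[OF H(2)] Hcurl_L2[OF H(3)]
    weak_curl(1)[OF H(1)] weak_curl(1)[OF H(2)] weak_curl(1)[OF H(3)]
  note wc = weak_curl(2)[OF H(1)] weak_curl(2)[OF H(2)] weak_curl(2)[OF H(3)]
  have "stokes_form \<Omega> (\<lambda>x. a *\<^sub>R u x + c *\<^sub>R v x) w = L2_inner \<Omega> (\<lambda>x. a *\<^sub>R u x + c *\<^sub>R v x) (weak_curl \<Omega> w)
    - L2_inner \<Omega> w (\<lambda>x. a *\<^sub>R weak_curl \<Omega> u x + c *\<^sub>R weak_curl \<Omega> v x)"
    by (rule stokes_form_eq[OF \<Omega> Hcurl_lincomb[OF \<Omega>m H(1,2)] H(3) L2_lincomb[OF L(1,2)] L(3)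
          L2_lincomb[OF L(4,5)] L(6) has_weak_curl_lincomb[OF \<Omega>m L(1,2,4,5) wc(1,2)] wc(3)])
       (simp_all add: ae_eq_def)
  then show ?thesis
    by (simp add: stokes_form_eq_weak_curl H L2_inner_lincomb_left[OF L(1,2,6)]
        L2_inner_lincomb_right[OF L(4,5,3)] algebra_simps)
qed

lemma stokes_form_lincomb_right:
  assumes \<Omega>: "open \<Omega>" and H: "u \<in> Hcurl \<Omega>" "v \<in> Hcurl \<Omega>" "w \<in> Hcurl \<Omega>"
  shows "stokes_form \<Omega> w (\<lambda>x. a *\<^sub>R u x + c *\<^sub>R v x) = a * stokes_form \<Omega> w u + c * stokes_form \<Omega> w v"
proof -
  have "\<Omega> \<in> sets lebesgue" using \<Omega> by simp
  note l = Hcurl_lincomb[OF this H(1,2), of a c]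
  show ?thesis
    using stokes_form_lincomb_left[OF assms, of a c] stokes_form_antisym[OF H(3) l]
      stokes_form_antisym[OF H(3,1)] stokes_form_antisym[OF H(3,2)] by simp
qed

lemma stokes_form_diff_left:
  assumes "open \<Omega>" "u \<in> Hcurl \<Omega>" "v \<in> Hcurl \<Omega>" "w \<in> Hcurl \<Omega>"
  shows "stokes_form \<Omega> (\<lambda>x. u x - v x) w = stokes_form \<Omega> u w - stokes_form \<Omega> v w"
  using stokes_form_lincomb_left[OF assms, of 1 "-1"] by simp

lemma stokes_form_bound:
  assumes u: "u \<in> Hcurl \<Omega>" and v: "v \<in> Hcurl \<Omega>"
  shows "\<bar>stokes_form \<Omega> u v\<bar> \<le> Hcurl_norm \<Omega> u * Hcurl_norm \<Omega> v"
proof -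
  define a b c d where "a = L2_norm \<Omega> u" and "b = L2_norm \<Omega> v"
    and "c = L2_norm \<Omega> (weak_curl \<Omega> u)" and "d = L2_norm \<Omega> (weak_curl \<Omega> v)"
  have "\<bar>stokes_form \<Omega> u v\<bar> \<le> a * d + b * c"
    using L2_Cauchy_Schwarz[OF Hcurl_L2[OF u] weak_curl(1)[OF v]]
      L2_Cauchy_Schwarz[OF Hcurl_L2[OF v] weak_curl(1)[OF u]]
    unfolding stokes_form_eq_weak_curl[OF assms] a_def b_def c_def d_def by linarith
  \<comment> \<open>Cauchy-Schwarz in the plane with the second pair swapped; the defect is the
    square of \<open>a * b - c * d\<close>.\<close>
  also have "(a * d + b * c)\<^sup>2 \<le> (a\<^sup>2 + c\<^sup>2) * (b\<^sup>2 + d\<^sup>2)"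
    using zero_le_power2[of "a * b - c * d"] by (simp add: power2_eq_square algebra_simps)
  then have "a * d + b * c \<le> sqrt ((a\<^sup>2 + c\<^sup>2) * (b\<^sup>2 + d\<^sup>2))" by (rule real_le_rsqrt)
  finally show ?thesis
    by (simp add: Hcurl_norm_def real_sqrt_mult a_def b_def c_def d_def)
qed

text \<open>The curl of an H1 field is almost everywhere the curl of its Jacobian, so the matrix
  bound integrates. The factor 2 is spent on the Jacobian part; the L2 part is merely enlarged to
  match.\<close>

lemma Hcurl_norm_le_H1v_norm:
  assumes \<Omega>: "open \<Omega>" and u: "u \<in> H1v \<Omega>"
  shows "Hcurl_norm \<Omega> u \<le> sqrt 2 * H1v_norm \<Omega> u"
proof -
  have \<Omega>m: "\<Omega> \<in> sets lebesgue" using \<Omega> by simp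
  let ?C = "\<lambda>x. curl_of_jac (weak_jac \<Omega> u x)"
  have uc: "u \<in> Hcurl \<Omega>" using u H1v_subset_Hcurl[OF \<Omega>m] by blast
  have CL: "?C \<in> L2 \<Omega>" by (rule L2_bounded_linear[OF bounded_linear_curl_of_jac weak_jac(1)[OF u]])
  have ae: "ae_eq \<Omega> (weak_curl \<Omega> u) ?C"
    by (rule has_weak_curl_unique[OF \<Omega> H1v_L2[OF u] H1v_L2[OF u] weak_curl(1)[OF uc] CL _ weak_curl(2)[OF uc]
          has_weak_curl_of_jac[OF \<Omega>m H1v_L2[OF u] weak_jac[OF u]]]) (simp add: ae_eq_def)
  have "(L2_norm \<Omega> (weak_curl \<Omega> u))\<^sup>2 = (L2_norm \<Omega> ?C)\<^sup>2"
    using L2_inner_cong_AE[OF weak_curl(1)[OF uc] CL ae weak_curl(1)[OF uc] CL ae] by (simp add: L2_inner_self)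
  also have "\<dots> = (\<integral>x. (norm (?C x))\<^sup>2 \<partial>lebesgue_on \<Omega>)" by (simp add: L2_norm_def)
  also have "\<dots> \<le> (\<integral>x. 2 * (norm (weak_jac \<Omega> u x))\<^sup>2 \<partial>lebesgue_on \<Omega>)"
    by (intro integral_mono L2_integrable_square CL integrable_mult_right weak_jac u norm_curl_of_jac)
  also have "\<dots> = 2 * (L2_norm \<Omega> (weak_jac \<Omega> u))\<^sup>2" by (simp add: L2_norm_def)
  finally have "(L2_norm \<Omega> u)\<^sup>2 + (L2_norm \<Omega> (weak_curl \<Omega> u))\<^sup>2 \<le> 2 * H1v_inner \<Omega> u u"
    unfolding H1v_inner_self[OF u] distrib_left using zero_le_power2[of "L2_norm \<Omega> u"] by linarith
  then show ?thesis
    unfolding Hcurl_norm_def H1v_norm_def by (simp flip: real_sqrt_mult)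
qed

subsection \<open>The kernel of the Stokes form and its orthogonal complement\<close>

text \<open>Phrased without boundary functionals, so that the orthogonal decomposition concerns
  fields on \<Omega> alone.\<close>

definition stokes_kernel :: "R3 set \<Rightarrow> (R3 \<Rightarrow> R3) set" where
  "stokes_kernel \<Omega> = {u \<in> H1v \<Omega>. \<forall>v\<in>H1v \<Omega>. stokes_form \<Omega> u v = 0}"

lemma L2_Pair:
  assumes "f \<in> L2 \<Omega>" "g \<in> L2 \<Omega>"
  shows "(\<lambda>x. (f x, g x)) \<in> L2 \<Omega>"
  by (rule L2I_bound[where g="\<lambda>x. (norm (f x))\<^sup>2 + (norm (g x))\<^sup>2"])
     (use assms L2_measurable[OF assms(1)] L2_measurable[OF assms(2)] in
       \<open>auto simp: norm_Pair intro!: L2_integrable_square borel_measurable_Pair\<close>)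

lemma L2_inner_Pair:
  assumes "f \<in> L2 \<Omega>" "g \<in> L2 \<Omega>" "f' \<in> L2 \<Omega>" "g' \<in> L2 \<Omega>"
  shows "L2_inner \<Omega> (\<lambda>x. (f x, g x)) (\<lambda>x. (f' x, g' x)) = L2_inner \<Omega> f f' + L2_inner \<Omega> g g'"
  using L2_inner_integrable[OF assms(1,3)] L2_inner_integrable[OF assms(2,4)]
  by (simp add: L2_inner_def)

text \<open>Pairing a field with its Jacobian embeds \<open>stokes_kernel\<close> into a space of square integrable
  functions as the orthogonal complement of a set: both the definition of the weak derivatives and
  the vanishing of the Stokes form are orthogonality relations.\<close>

lemma stokes_kernel_decomposition:
  assumes \<Omega>: "open \<Omega>" "bounded \<Omega>" and v: "v \<in> H1v \<Omega>"
  obtains w where "w \<in> H1v \<Omega>" "(\<lambda>x. v x - w x) \<in> stokes_kernel \<Omega>"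
    "\<forall>k\<in>stokes_kernel \<Omega>. H1v_inner \<Omega> w k = 0"
proof -
  have \<Omega>m: "\<Omega> \<in> sets lebesgue" using \<Omega> by simp
  have fin: "finite_measure (lebesgue_on \<Omega>)"
    using \<Omega> by (intro finite_measure_lebesgue_on lmeasurable_open)
  have sub: "H1v \<Omega> \<subseteq> Hcurl \<Omega>" by (rule H1v_subset_Hcurl[OF \<Omega>m])
  \<comment> \<open>The adjoint moves the curl from the unknown Jacobian to the fixed field, turning
    the vanishing of the Stokes form into orthogonality to \<open>a2 u\<close>.\<close>
  let ?C' = "adjoint curl_of_jac"
  have C': "bounded_linear ?C'"
    using adjoint_linear[OF linear_curl_of_jac] by (simp add: linear_conv_bounded_linear)
  \<comment> \<open>Orthogonality to \<open>a1 \<phi> j i\<close> is the weak derivative identity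
    for component \<open>j\<close> in direction \<open>i\<close>, tested with
    \<open>\<phi>\<close>.\<close>
  define a1 :: "(R3 \<Rightarrow> real) \<Rightarrow> 3 \<Rightarrow> 3 \<Rightarrow> R3 \<Rightarrow> R3 \<times> (real^3^3)" where
    "a1 = (\<lambda>\<phi> j i x. (axis j (grad \<phi> x $ i), axis j (axis i (\<phi> x))))"
  define a2 :: "(R3 \<Rightarrow> R3) \<Rightarrow> R3 \<Rightarrow> R3 \<times> (real^3^3)" where
    "a2 = (\<lambda>u x. (weak_curl \<Omega> u x, (-1) *\<^sub>R ?C' (u x)))"
  define A where "A = {a1 \<phi> j i | \<phi> j i. test_function \<Omega> \<phi>} \<union> a2 ` H1v \<Omega>"
  have a1_L2: "(\<lambda>x. axis j (grad \<phi> x $ i) :: R3) \<in> L2 \<Omega>" "(\<lambda>x. axis j (axis i (\<phi> x)) :: real^3^3) \<in> L2 \<Omega>"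
    if "test_function \<Omega> \<phi>" for \<phi> i j
    using test_function_L2[OF \<Omega>m that] test_function_L2[OF \<Omega>m test_function_grad[OF that]]
    by (auto intro: L2_bounded_linear[OF bounded_linear_axis])
  have a2_L2: "weak_curl \<Omega> u \<in> L2 \<Omega>" "(\<lambda>x. (-1) *\<^sub>R ?C' (u x)) \<in> L2 \<Omega>" if "u \<in> H1v \<Omega>" for u
    using weak_curl(1) sub that L2_scale[OF L2_bounded_linear[OF C' H1v_L2[OF that]], of "-1"] by auto
  have A: "A \<subseteq> L2 \<Omega>"
    unfolding A_def a1_def a2_def using a1_L2 a2_L2 by (auto intro: L2_Pair)
  define S where "S = {p \<in> L2 \<Omega>. \<forall>a\<in>A. L2_inner \<Omega> p a = 0}"
  have S_iff: "(\<lambda>x. (u x, G x)) \<in> S \<longleftrightarrow> has_weak_jac \<Omega> u G \<and>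
      (\<forall>h\<in>H1v \<Omega>. L2_inner \<Omega> u (weak_curl \<Omega> h) - L2_inner \<Omega> h (\<lambda>x. curl_of_jac (G x)) = 0)"
    if u: "u \<in> L2 \<Omega>" and G: "G \<in> L2 \<Omega>" for u G
  proof -
    have 1: "L2_inner \<Omega> (\<lambda>x. (u x, G x)) (a1 \<phi> j i)
        = L2_inner \<Omega> (\<lambda>x. u x $ j) (\<lambda>x. grad \<phi> x $ i) + L2_inner \<Omega> (\<lambda>x. G x $ j $ i) \<phi>"
      if "test_function \<Omega> \<phi>" for \<phi> j i
      unfolding a1_def L2_inner_Pair[OF u G a1_L2[OF that]]
      by (simp add: L2_inner_def inner_axis)
    have 2: "L2_inner \<Omega> (\<lambda>x. (u x, G x)) (a2 h)
        = L2_inner \<Omega> u (weak_curl \<Omega> h) - L2_inner \<Omega> h (\<lambda>x. curl_of_jac (G x))" if "h \<in> H1v \<Omega>" for h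
      unfolding a2_def L2_inner_Pair[OF u G a2_L2[OF that]]
      by (simp add: L2_inner_def adjoint_works[OF linear_curl_of_jac] inner_commute)
    have 3: "has_weak_jac \<Omega> u G \<longleftrightarrow> (\<forall>\<phi> j i. test_function \<Omega> \<phi> \<longrightarrow>
        L2_inner \<Omega> (\<lambda>x. u x $ j) (\<lambda>x. grad \<phi> x $ i) + L2_inner \<Omega> (\<lambda>x. G x $ j $ i) \<phi> = 0)"
      unfolding has_weak_jac_def has_weak_grad_iff[OF \<Omega>m vec_L2D[OF u] vec_L2D[OF G]] by blast
    have "(\<lambda>x. (u x, G x)) \<in> S \<longleftrightarrow> (\<forall>a\<in>A. L2_inner \<Omega> (\<lambda>x. (u x, G x)) a = 0)"
      using L2_Pair[OF u G] by (simp add: S_def)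
    also have "\<dots> \<longleftrightarrow> (\<forall>\<phi> j i. test_function \<Omega> \<phi> \<longrightarrow> L2_inner \<Omega> (\<lambda>x. (u x, G x)) (a1 \<phi> j i) = 0)
        \<and> (\<forall>h\<in>H1v \<Omega>. L2_inner \<Omega> (\<lambda>x. (u x, G x)) (a2 h) = 0)"
      unfolding A_def by blast
    finally show ?thesis using 1 2 3 by simp
  qed
  define P where "P = (\<lambda>x. (v x, weak_jac \<Omega> v x))"
  have P: "P \<in> L2 \<Omega>" unfolding P_def by (intro L2_Pair H1v_L2 weak_jac v)
  obtain p where pS: "p \<in> S" and orth: "\<forall>s\<in>S. L2_inner \<Omega> (\<lambda>x. P x - p x) s = 0"
    unfolding S_def by (rule L2_projection[OF fin A P])
  define k where "k = (\<lambda>x. fst (p x))"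
  define G where "G = (\<lambda>x. snd (p x))"
  \<comment> \<open>By \<open>S_iff\<close> the second entry of the projection is automatically a
    weak Jacobian of the first, so \<open>k\<close> is an H1 field.\<close>
  have p_eq: "p = (\<lambda>x. (k x, G x))" by (simp add: k_def G_def)
  have p_L2: "p \<in> L2 \<Omega>" using pS by (simp add: S_def)
  have kL: "k \<in> L2 \<Omega>" and GL: "G \<in> L2 \<Omega>"
    unfolding k_def G_def
    by (intro L2_bounded_linear[OF bounded_linear_fst] L2_bounded_linear[OF bounded_linear_snd] p_L2)+
  have kG: "has_weak_jac \<Omega> k G"
    and kG0: "\<And>h. h \<in> H1v \<Omega> \<Longrightarrow> L2_inner \<Omega> k (weak_curl \<Omega> h) - L2_inner \<Omega> h (\<lambda>x. curl_of_jac (G x)) = 0"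
    using pS unfolding p_eq S_iff[OF kL GL] by blast+
  have kH: "k \<in> H1v \<Omega>" by (rule H1vI[OF kL GL kG])
  have stokes: "stokes_form \<Omega> u h = L2_inner \<Omega> u (weak_curl \<Omega> h) - L2_inner \<Omega> h (\<lambda>x. curl_of_jac (H x))"
    if "u \<in> L2 \<Omega>" "H \<in> L2 \<Omega>" "has_weak_jac \<Omega> u H" "h \<in> H1v \<Omega>" for u H h
  proof (rule stokes_form_eq[OF \<Omega>(1)])
    show "u \<in> Hcurl \<Omega>" "h \<in> Hcurl \<Omega>" using that H1vI sub by blast+
    then show "weak_curl \<Omega> h \<in> L2 \<Omega>" "has_weak_curl \<Omega> h (weak_curl \<Omega> h)" by (blast intro: weak_curl)+
    show "(\<lambda>x. curl_of_jac (H x)) \<in> L2 \<Omega>" by (rule L2_bounded_linear[OF bounded_linear_curl_of_jac that(2)])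
    show "has_weak_curl \<Omega> u (\<lambda>x. curl_of_jac (H x))" by (rule has_weak_curl_of_jac[OF \<Omega>m that(1-3)])
    show "u \<in> L2 \<Omega>" "h \<in> L2 \<Omega>" using that H1v_L2 by blast+
  qed (simp_all add: ae_eq_def)
  show thesis
  proof
    show "(\<lambda>x. v x - k x) \<in> H1v \<Omega>" by (rule H1v_diff[OF \<Omega>(1) v kH])
    have "k \<in> stokes_kernel \<Omega>"
      using kH kG0 by (simp add: stokes_kernel_def stokes[OF kL GL kG])
    then show "(\<lambda>x. v x - (v x - k x)) \<in> stokes_kernel \<Omega>" by simp
    show "\<forall>l\<in>stokes_kernel \<Omega>. H1v_inner \<Omega> (\<lambda>x. v x - k x) l = 0"
    proof
      fix l assume "l \<in> stokes_kernel \<Omega>"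
      then have l: "l \<in> H1v \<Omega>" and l0: "\<And>h. h \<in> H1v \<Omega> \<Longrightarrow> stokes_form \<Omega> l h = 0"
        by (auto simp: stokes_kernel_def)
      note lL = H1v_L2[OF l] and J = weak_jac[OF l]
      have "(\<lambda>x. (l x, weak_jac \<Omega> l x)) \<in> S"
        unfolding S_iff[OF lL J(1)] using J(2) l0 stokes[OF lL J] by simp
      then have "0 = L2_inner \<Omega> (\<lambda>x. P x - p x) (\<lambda>x. (l x, weak_jac \<Omega> l x))"
        using orth by simp
      also have "(\<lambda>x. P x - p x) = (\<lambda>x. (v x - k x, weak_jac \<Omega> v x - G x))"
        by (simp add: P_def p_eq)
      also have "L2_inner \<Omega> \<dots> (\<lambda>x. (l x, weak_jac \<Omega> l x))
          = L2_inner \<Omega> (\<lambda>x. v x - k x) l + L2_inner \<Omega> (\<lambda>x. weak_jac \<Omega> v x - G x) (weak_jac \<Omega> l)"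
        by (intro L2_inner_Pair L2_diff H1v_L2 weak_jac v kL GL l)
      \<comment> \<open>The difference of Jacobians is a weak Jacobian of \<open>v - k\<close>, so
        the L2 product of the pairs is the H1 product of the fields.\<close>
      also have "\<dots> = H1v_inner \<Omega> (\<lambda>x. v x - k x) l"
        using has_weak_jac_lincomb[OF \<Omega>m H1v_L2[OF v] kL weak_jac(1)[OF v] GL weak_jac(2)[OF v] kG, of 1 "-1"]
        by (intro H1v_inner_eq[symmetric] \<Omega>(1) L2_diff H1v_L2 weak_jac v kL GL l) simp
      finally show "H1v_inner \<Omega> (\<lambda>x. v x - k x) l = 0" by simp
    qed
  qed
qed

subsection \<open>Tangential traces\<close>

locale tangential_trace =
  fixes \<Omega> :: "R3 set" and TrT :: "(R3 \<Rightarrow> R3) \<Rightarrow> bdry_functional"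
  assumes open_\<Omega>: "open \<Omega>" and bounded_\<Omega>: "bounded \<Omega>" and TrT: "is_tangential_trace \<Omega> TrT"
begin

section \<open>The kernel of the tangential trace\<close>

lemma H1v_Hcurl: "u \<in> H1v \<Omega> \<Longrightarrow> u \<in> Hcurl \<Omega>"
  using H1v_subset_Hcurl[of \<Omega>] open_\<Omega> by auto

lemma TrT_Trv:
  assumes "u \<in> H1v \<Omega>" "v \<in> H1v \<Omega>"
  shows "TrT u (Trv \<Omega> v) = stokes_form \<Omega> u v"
  using TrT assms qe_eq_refl unfolding is_tangential_trace_def qe_eqv_def by blast

text \<open>Lifting componentwise gives a single field \<open>v\<close> that evaluates all
  functionals \<open>TrT u\<close> at \<open>g\<close> at once.\<close>

lemma Bv_lift:
  assumes "g \<in> Bv \<Omega>"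
  obtains v where "v \<in> H1v \<Omega>" "\<And>u. u \<in> H1v \<Omega> \<Longrightarrow> TrT u g = stokes_form \<Omega> u v"
proof -
  have "\<forall>i. \<exists>w\<in>H1 \<Omega>. qe_eq \<Omega> (Tr \<Omega> w) (\<lambda>x. g x $ i)"
    using assms by (simp add: Bv_def trace_space_def)
  then obtain w where w: "\<And>i. w i \<in> H1 \<Omega>" "\<And>i. qe_eq \<Omega> (Tr \<Omega> (w i)) (\<lambda>x. g x $ i)"
    by metis
  define v :: "R3 \<Rightarrow> R3" where "v = (\<lambda>x. \<chi> i. w i x)"
  have v: "v \<in> H1v \<Omega>" "qe_eqv \<Omega> (Trv \<Omega> v) g"
    using w by (simp_all add: H1v_def v_def qe_eqv_def Trv_def)
  then show thesis using that TrT unfolding is_tangential_trace_def by blast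
qed

lemma TrT_outside: "u \<in> H1v \<Omega> \<Longrightarrow> g \<notin> Bv \<Omega> \<Longrightarrow> TrT u g = 0"
  using TrT by (simp add: is_tangential_trace_def dual_def)

text \<open>Functionals are compared at every argument: in \<open>Bv\<close> through a lift, outside
  through the normalisation to 0 built into \<open>dual\<close>.\<close>

lemma TrT_eq_iff:
  assumes u: "u \<in> H1v \<Omega>" "u' \<in> H1v \<Omega>"
  shows "TrT u = TrT u' \<longleftrightarrow> (\<forall>v\<in>H1v \<Omega>. stokes_form \<Omega> u v = stokes_form \<Omega> u' v)"
proof
  assume "TrT u = TrT u'"
  then show "\<forall>v\<in>H1v \<Omega>. stokes_form \<Omega> u v = stokes_form \<Omega> u' v"
    using u by (metis TrT_Trv)
next
  assume R: "\<forall>v\<in>H1v \<Omega>. stokes_form \<Omega> u v = stokes_form \<Omega> u' v"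
  show "TrT u = TrT u'"
  proof
    fix g
    show "TrT u g = TrT u' g"
      using R u by (cases "g \<in> Bv \<Omega>") (metis Bv_lift, simp add: TrT_outside)
  qed
qed

lemma ker_TrT_eq: "ker_TrT \<Omega> TrT = stokes_kernel \<Omega>"
proof (intro set_eqI iffI)
  fix u assume "u \<in> ker_TrT \<Omega> TrT"
  then have u: "u \<in> H1v \<Omega>" "TrT u = (\<lambda>_. 0)" by (auto simp: ker_TrT_def)
  then show "u \<in> stokes_kernel \<Omega>"
    using TrT_Trv[OF u(1)] by (simp add: stokes_kernel_def)
next
  fix u assume "u \<in> stokes_kernel \<Omega>"
  then have u: "u \<in> H1v \<Omega>" "\<And>v. v \<in> H1v \<Omega> \<Longrightarrow> stokes_form \<Omega> u v = 0"
    by (auto simp: stokes_kernel_def)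
  have "TrT u g = 0" for g
    using u by (cases "g \<in> Bv \<Omega>") (metis Bv_lift, simp add: TrT_outside)
  then show "u \<in> ker_TrT \<Omega> TrT" using u by (auto simp: ker_TrT_def)
qed

lemma stokes_kernel_diff_iff:
  assumes "u \<in> H1v \<Omega>" "u' \<in> H1v \<Omega>"
  shows "(\<lambda>x. u x - u' x) \<in> stokes_kernel \<Omega> \<longleftrightarrow> (\<forall>v\<in>H1v \<Omega>. stokes_form \<Omega> u v = stokes_form \<Omega> u' v)"
  using H1v_diff[OF open_\<Omega> assms] stokes_form_diff_left[OF open_\<Omega> H1v_Hcurl[OF assms(1)] H1v_Hcurl[OF assms(2)] H1v_Hcurl]
  by (simp add: stokes_kernel_def)

section \<open>Optimal lifts and the tangential component trace\<close>

lemma Kperp_H1v: "w \<in> Kperp \<Omega> TrT \<Longrightarrow> w \<in> H1v \<Omega>"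
  by (simp add: Kperp_def)

lemma Kperp_orthogonal: "w \<in> Kperp \<Omega> TrT \<Longrightarrow> k \<in> stokes_kernel \<Omega> \<Longrightarrow> H1v_inner \<Omega> w k = 0"
  by (simp add: Kperp_def ker_TrT_eq)

lemma stokes_kernel_H1v: "k \<in> stokes_kernel \<Omega> \<Longrightarrow> k \<in> H1v \<Omega>"
  by (simp add: stokes_kernel_def)

lemma Kperp_lincomb:
  assumes "w \<in> Kperp \<Omega> TrT" "w' \<in> Kperp \<Omega> TrT"
  shows "(\<lambda>x. a *\<^sub>R w x + c *\<^sub>R w' x) \<in> Kperp \<Omega> TrT"
  unfolding Kperp_def ker_TrT_eq
  using H1v_lincomb[OF open_\<Omega> Kperp_H1v[OF assms(1)] Kperp_H1v[OF assms(2)]]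
    H1v_inner_lincomb_left[OF open_\<Omega> Kperp_H1v[OF assms(1)] Kperp_H1v[OF assms(2)] stokes_kernel_H1v]
    Kperp_orthogonal[OF assms(1)] Kperp_orthogonal[OF assms(2)]
  by simp

text \<open>Stated by Stokes pairings, so that the same field provides the lift for
  \<open>TrT\<close> and for \<open>piT\<close>.\<close>

lemma Kperp_projection:
  assumes "v \<in> H1v \<Omega>"
  obtains w where "w \<in> Kperp \<Omega> TrT" "\<And>u. u \<in> H1v \<Omega> \<Longrightarrow> stokes_form \<Omega> w u = stokes_form \<Omega> v u"
proof -
  obtain w where w: "w \<in> H1v \<Omega>" "(\<lambda>x. v x - w x) \<in> stokes_kernel \<Omega>"
    "\<forall>k\<in>stokes_kernel \<Omega>. H1v_inner \<Omega> w k = 0"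
    by (rule stokes_kernel_decomposition[OF open_\<Omega> bounded_\<Omega> assms])
  show thesis
  proof
    show "w \<in> Kperp \<Omega> TrT" using w(1,3) by (simp add: Kperp_def ker_TrT_eq)
    show "stokes_form \<Omega> w u = stokes_form \<Omega> v u" if "u \<in> H1v \<Omega>" for u
      using stokes_kernel_diff_iff[OF assms w(1)] w(2) that by simp
  qed
qed

lemma piT_TrT:
  assumes u: "u \<in> H1v \<Omega>" and v: "v \<in> H1v \<Omega>"
  shows "piT \<Omega> TrT u (TrT v) = - stokes_form \<Omega> u v"
proof -
  obtain w0 where w0: "w0 \<in> Kperp \<Omega> TrT" "\<And>u. u \<in> H1v \<Omega> \<Longrightarrow> stokes_form \<Omega> w0 u = stokes_form \<Omega> v u"
    using Kperp_projection[OF v] by blast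
  then have "TrT w0 = TrT v" using TrT_eq_iff[OF Kperp_H1v v] by simp
  define w where "w = lift_perp \<Omega> TrT (TrT v)"
  have "\<exists>w. w \<in> Kperp \<Omega> TrT \<and> TrT w = TrT v" using w0(1) \<open>TrT w0 = TrT v\<close> by blast
  from someI_ex[OF this] have w: "w \<in> H1v \<Omega>" "TrT w = TrT v"
    by (auto simp: w_def lift_perp_def intro: Kperp_H1v)
  have "stokes_form \<Omega> w u = stokes_form \<Omega> v u" using w TrT_eq_iff[OF w(1) v] u by simp
  \<comment> \<open>Equality of traces controls the left slot; antisymmetry transfers it to the
    right one.\<close>
  then have "stokes_form \<Omega> u w = stokes_form \<Omega> u v"
    using stokes_form_antisym[OF H1v_Hcurl[OF u] H1v_Hcurl[OF w(1)]]
      stokes_form_antisym[OF H1v_Hcurl[OF u] H1v_Hcurl[OF v]] by simp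
  then show ?thesis using v by (simp add: piT_def B_perp_def w_def)
qed

lemma piT_outside: "f \<notin> B_perp \<Omega> TrT \<Longrightarrow> piT \<Omega> TrT u f = 0"
  by (simp add: piT_def)

lemma piT_eq_iff:
  assumes u: "u \<in> H1v \<Omega>" "u' \<in> H1v \<Omega>"
  shows "piT \<Omega> TrT u = piT \<Omega> TrT u' \<longleftrightarrow> (\<lambda>x. u x - u' x) \<in> stokes_kernel \<Omega>"
proof -
  have "piT \<Omega> TrT u = piT \<Omega> TrT u' \<longleftrightarrow> (\<forall>v\<in>H1v \<Omega>. piT \<Omega> TrT u (TrT v) = piT \<Omega> TrT u' (TrT v))"
    (is "_ \<longleftrightarrow> ?R")
  proof
    assume R: ?R
    show "piT \<Omega> TrT u = piT \<Omega> TrT u'"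
    proof
      fix f
      show "piT \<Omega> TrT u f = piT \<Omega> TrT u' f"
        using R by (cases "f \<in> B_perp \<Omega> TrT") (auto simp: B_perp_def piT_outside)
    qed
  qed simp
  then show ?thesis using stokes_kernel_diff_iff[OF u] piT_TrT u by simp
qed

lemma piT_lincomb:
  assumes u: "u \<in> H1v \<Omega>" and v: "v \<in> H1v \<Omega>"
  shows "piT \<Omega> TrT (\<lambda>x. a *\<^sub>R u x + c *\<^sub>R v x) = (\<lambda>f. a *\<^sub>R piT \<Omega> TrT u f + c *\<^sub>R piT \<Omega> TrT v f)"
proof
  fix f
  show "piT \<Omega> TrT (\<lambda>x. a *\<^sub>R u x + c *\<^sub>R v x) f = a *\<^sub>R piT \<Omega> TrT u f + c *\<^sub>R piT \<Omega> TrT v f"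
  proof (cases "f \<in> B_perp \<Omega> TrT")
    case True
    then obtain g where "g \<in> H1v \<Omega>" "f = TrT g" by (auto simp: B_perp_def)
    then show ?thesis
      using stokes_form_lincomb_left[OF open_\<Omega> H1v_Hcurl[OF u] H1v_Hcurl[OF v] H1v_Hcurl, of g a c]
      by (simp add: piT_TrT u v H1v_lincomb[OF open_\<Omega> u v])
  qed (simp add: piT_outside)
qed

lemma lift_T:
  assumes "f \<in> B_T \<Omega> TrT"
  shows "lift_T \<Omega> TrT f \<in> Kperp \<Omega> TrT" "piT \<Omega> TrT (lift_T \<Omega> TrT f) = f"
proof -
  obtain v where v: "v \<in> H1v \<Omega>" "f = piT \<Omega> TrT v" using assms by (auto simp: B_T_def)
  obtain w where w: "w \<in> Kperp \<Omega> TrT" "\<And>u. u \<in> H1v \<Omega> \<Longrightarrow> stokes_form \<Omega> w u = stokes_form \<Omega> v u"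
    using Kperp_projection[OF v(1)] by blast
  have "piT \<Omega> TrT w = f"
    using piT_eq_iff[OF Kperp_H1v[OF w(1)] v(1)] stokes_kernel_diff_iff[OF Kperp_H1v[OF w(1)] v(1)] w(2) v(2)
    by simp
  then have "\<exists>w. w \<in> Kperp \<Omega> TrT \<and> piT \<Omega> TrT w = f" using w(1) by blast
  from someI_ex[OF this] show "lift_T \<Omega> TrT f \<in> Kperp \<Omega> TrT" "piT \<Omega> TrT (lift_T \<Omega> TrT f) = f"
    by (simp_all add: lift_T_def)
qed

text \<open>The difference lies both in the kernel and in its orthogonal complement, so it is
  orthogonal to itself and vanishes almost everywhere.\<close>

lemma lift_unique:
  assumes w: "w \<in> Kperp \<Omega> TrT" "w' \<in> Kperp \<Omega> TrT" and eq: "piT \<Omega> TrT w = piT \<Omega> TrT w'"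
  shows "ae_eq \<Omega> w w'"
proof -
  let ?d = "\<lambda>x. w x - w' x"
  have "?d \<in> stokes_kernel \<Omega>" using eq piT_eq_iff[OF Kperp_H1v[OF w(1)] Kperp_H1v[OF w(2)]] by simp
  moreover have "?d \<in> Kperp \<Omega> TrT" using Kperp_lincomb[OF w, of 1 "-1"] by simp
  ultimately have "AE x in lebesgue_on \<Omega>. ?d x = 0"
    by (intro H1v_inner_self_eq_0 Kperp_orthogonal Kperp_H1v)
  then show ?thesis by (simp add: ae_eq_def)
qed

section \<open>The tangential trace on H(curl)\<close>

lemma TrT_ext_eq:
  assumes u: "u \<in> Hcurl \<Omega>" and w: "w \<in> Kperp \<Omega> TrT"
  shows "TrT_ext \<Omega> TrT u (piT \<Omega> TrT w) = stokes_form \<Omega> u w"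
proof -
  have f: "piT \<Omega> TrT w \<in> B_T \<Omega> TrT" using Kperp_H1v[OF w] by (simp add: B_T_def)
  have "stokes_form \<Omega> u (lift_T \<Omega> TrT (piT \<Omega> TrT w)) = stokes_form \<Omega> u w"
    by (rule stokes_form_cong_AE[OF open_\<Omega> u u H1v_Hcurl[OF Kperp_H1v[OF lift_T(1)[OF f]]] H1v_Hcurl[OF Kperp_H1v[OF w]]
          _ lift_unique[OF lift_T(1)[OF f] w lift_T(2)[OF f]]]) (simp add: ae_eq_def)
  then show ?thesis using f by (simp add: TrT_ext_def)
qed

lemma TrT_ext_outside: "f \<notin> B_T \<Omega> TrT \<Longrightarrow> TrT_ext \<Omega> TrT u f = 0"
  by (simp add: TrT_ext_def)

text \<open>The field \<open>v\<close> may differ from the optimal lift by a kernel element. That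
  element pairs to 0 with every H1 field by definition, which is why \<open>u\<close> is taken in H1
  here.\<close>

lemma TrT_ext_piT:
  assumes u: "u \<in> H1v \<Omega>" and v: "v \<in> H1v \<Omega>"
  shows "TrT_ext \<Omega> TrT u (piT \<Omega> TrT v) = stokes_form \<Omega> u v"
proof -
  have f: "piT \<Omega> TrT v \<in> B_T \<Omega> TrT" using v by (simp add: B_T_def)
  define w where "w = lift_T \<Omega> TrT (piT \<Omega> TrT v)"
  have w: "w \<in> Kperp \<Omega> TrT" "piT \<Omega> TrT w = piT \<Omega> TrT v" using lift_T[OF f] by (simp_all add: w_def)
  note wH = Kperp_H1v[OF w(1)]
  have "stokes_form \<Omega> w u = stokes_form \<Omega> v u"
    using piT_eq_iff[OF wH v] stokes_kernel_diff_iff[OF wH v] w(2) u by simp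
  then have "stokes_form \<Omega> u w = stokes_form \<Omega> u v"
    using stokes_form_antisym[OF H1v_Hcurl[OF u] H1v_Hcurl[OF wH]]
      stokes_form_antisym[OF H1v_Hcurl[OF u] H1v_Hcurl[OF v]] by simp
  then show ?thesis using TrT_ext_eq[OF H1v_Hcurl[OF u] w(1)] w(2) by simp
qed

text \<open>Every competitor is \<open>w\<close> plus a kernel element orthogonal to it, so by
  Pythagoras the infimum is attained at \<open>w\<close>.\<close>

lemma B_T_norm_piT:
  assumes w: "w \<in> Kperp \<Omega> TrT"
  shows "B_T_norm \<Omega> TrT (piT \<Omega> TrT w) = H1v_norm \<Omega> w"
  unfolding B_T_norm_def
proof (rule cInf_eq_minimum)
  note wH = Kperp_H1v[OF w]
  show "H1v_norm \<Omega> w \<in> {H1v_norm \<Omega> v |v. v \<in> H1v \<Omega> \<and> piT \<Omega> TrT v = piT \<Omega> TrT w}"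
    using wH by blast
  fix r assume "r \<in> {H1v_norm \<Omega> v |v. v \<in> H1v \<Omega> \<and> piT \<Omega> TrT v = piT \<Omega> TrT w}"
  then obtain v where v: "v \<in> H1v \<Omega>" "piT \<Omega> TrT v = piT \<Omega> TrT w" "r = H1v_norm \<Omega> v" by blast
  let ?k = "\<lambda>x. v x - w x"
  have k: "?k \<in> stokes_kernel \<Omega>" using piT_eq_iff[OF v(1) wH] v(2) by simp
  note kH = stokes_kernel_H1v[OF k]
  have "H1v_inner \<Omega> v v = H1v_inner \<Omega> w w + 2 * H1v_inner \<Omega> w ?k + H1v_inner \<Omega> ?k ?k"
    using H1v_inner_self_add[OF open_\<Omega> wH kH] by simp
  then have "H1v_inner \<Omega> w w \<le> H1v_inner \<Omega> v v"
    using Kperp_orthogonal[OF w k] H1v_inner_self_nonneg[OF kH] by simp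
  then show "H1v_norm \<Omega> w \<le> r" by (simp add: H1v_norm_def v(3))
qed

lemma TrT_ext_bound:
  assumes u: "u \<in> Hcurl \<Omega>" and f: "f \<in> B_T \<Omega> TrT"
  shows "\<bar>TrT_ext \<Omega> TrT u f\<bar> \<le> sqrt 2 * Hcurl_norm \<Omega> u * B_T_norm \<Omega> TrT f"
proof -
  obtain w where w: "w \<in> Kperp \<Omega> TrT" "f = piT \<Omega> TrT w" using lift_T[OF f] by metis
  note wH = Kperp_H1v[OF w(1)]
  have "\<bar>TrT_ext \<Omega> TrT u f\<bar> \<le> Hcurl_norm \<Omega> u * Hcurl_norm \<Omega> w"
    using stokes_form_bound[OF u H1v_Hcurl[OF wH]] by (simp add: w(2) TrT_ext_eq[OF u w(1)])
  also have "\<dots> \<le> Hcurl_norm \<Omega> u * (sqrt 2 * H1v_norm \<Omega> w)"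
    by (intro mult_left_mono Hcurl_norm_le_H1v_norm open_\<Omega> wH) (simp add: Hcurl_norm_def)
  finally show ?thesis by (simp add: w(2) B_T_norm_piT[OF w(1)] mult_ac)
qed

text \<open>A combination of optimal lifts is again orthogonal to the kernel, hence is the optimal
  lift of the combination.\<close>

lemma TrT_ext_lincomb_right:
  assumes u: "u \<in> Hcurl \<Omega>" and f: "f \<in> B_T \<Omega> TrT" and g: "g \<in> B_T \<Omega> TrT"
  shows "TrT_ext \<Omega> TrT u (\<lambda>x. a *\<^sub>R f x + c *\<^sub>R g x) = a * TrT_ext \<Omega> TrT u f + c * TrT_ext \<Omega> TrT u g"
proof -
  obtain v where v: "v \<in> Kperp \<Omega> TrT" "f = piT \<Omega> TrT v" using lift_T[OF f] by metis
  obtain w where w: "w \<in> Kperp \<Omega> TrT" "g = piT \<Omega> TrT w" using lift_T[OF g] by metis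
  have "(\<lambda>x. a *\<^sub>R f x + c *\<^sub>R g x) = piT \<Omega> TrT (\<lambda>x. a *\<^sub>R v x + c *\<^sub>R w x)"
    by (simp add: v(2) w(2) piT_lincomb[OF Kperp_H1v[OF v(1)] Kperp_H1v[OF w(1)]])
  then show ?thesis
    using stokes_form_lincomb_right[OF open_\<Omega> H1v_Hcurl[OF Kperp_H1v[OF v(1)]] H1v_Hcurl[OF Kperp_H1v[OF w(1)]] u]
    by (simp add: v(2) w(2) TrT_ext_eq[OF u] v(1) w(1) Kperp_lincomb)
qed

lemma TrT_ext_dual:
  assumes "u \<in> Hcurl \<Omega>"
  shows "TrT_ext \<Omega> TrT u \<in> dual (B_T \<Omega> TrT) (B_T_norm \<Omega> TrT)"
  unfolding dual_def using assms TrT_ext_lincomb_right TrT_ext_bound TrT_ext_outside by blast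

lemma TrT_ext_dual_norm:
  assumes u: "u \<in> Hcurl \<Omega>"
  shows "dual_norm (B_T \<Omega> TrT) (B_T_norm \<Omega> TrT) (TrT_ext \<Omega> TrT u) \<le> sqrt 2 * Hcurl_norm \<Omega> u"
  unfolding dual_norm_def
proof (rule cSup_least)
  \<comment> \<open>A bound on a real supremum requires a nonempty set; the image of the zero field,
    of norm 0, supplies a member. Its norm is computed from the explicit zero Jacobian.\<close>
  have "has_weak_jac \<Omega> (\<lambda>x. 0) (\<lambda>x. 0)" by (simp add: has_weak_jac_def has_weak_grad_def)
  then have z: "H1v_inner \<Omega> (\<lambda>x. 0) k = 0" if "k \<in> H1v \<Omega>" for k
    using H1v_inner_eq[OF open_\<Omega> L2_zero H1v_L2[OF that] L2_zero weak_jac(1)[OF that] _ weak_jac(2)[OF that]]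
    by (simp add: L2_inner_def)
  have zH: "(\<lambda>x. 0) \<in> H1v \<Omega>"
    by (rule H1vI[OF L2_zero L2_zero \<open>has_weak_jac \<Omega> (\<lambda>x. 0) (\<lambda>x. 0)\<close>])
  then have zK: "(\<lambda>x. 0) \<in> Kperp \<Omega> TrT"
    using z by (simp add: Kperp_def ker_TrT_def)
  have "piT \<Omega> TrT (\<lambda>x. 0) \<in> B_T \<Omega> TrT" "B_T_norm \<Omega> TrT (piT \<Omega> TrT (\<lambda>x. 0)) \<le> 1"
    using zH z[OF zH] B_T_norm_piT[OF zK] by (simp_all add: B_T_def H1v_norm_def)
  then show "{\<bar>TrT_ext \<Omega> TrT u f\<bar> |f. f \<in> B_T \<Omega> TrT \<and> B_T_norm \<Omega> TrT f \<le> 1} \<noteq> {}" by blast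
  fix r assume "r \<in> {\<bar>TrT_ext \<Omega> TrT u f\<bar> |f. f \<in> B_T \<Omega> TrT \<and> B_T_norm \<Omega> TrT f \<le> 1}"
  then obtain f where f: "f \<in> B_T \<Omega> TrT" "B_T_norm \<Omega> TrT f \<le> 1" "r = \<bar>TrT_ext \<Omega> TrT u f\<bar>" by blast
  have "r \<le> sqrt 2 * Hcurl_norm \<Omega> u * B_T_norm \<Omega> TrT f" using TrT_ext_bound[OF u f(1)] f(3) by simp
  also have "\<dots> \<le> sqrt 2 * Hcurl_norm \<Omega> u * 1"
    using f(2) by (intro mult_left_mono) (simp_all add: Hcurl_norm_def)
  finally show "r \<le> sqrt 2 * Hcurl_norm \<Omega> u" by simp
qed

text \<open>For each \<open>f\<close> all three values use the same chosen lift, so linearity of the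
  Stokes form in its left slot suffices.\<close>

lemma TrT_ext_lincomb:
  assumes u: "u \<in> Hcurl \<Omega>" and v: "v \<in> Hcurl \<Omega>"
  shows "TrT_ext \<Omega> TrT (\<lambda>x. a *\<^sub>R u x + c *\<^sub>R v x)
    = (\<lambda>f. a * TrT_ext \<Omega> TrT u f + c * TrT_ext \<Omega> TrT v f)"
  using stokes_form_lincomb_left[OF open_\<Omega> u v H1v_Hcurl[OF Kperp_H1v[OF lift_T(1)]]]
  by (auto simp: TrT_ext_def)

lemma TrT_ext_cong_AE:
  assumes "u \<in> Hcurl \<Omega>" "u' \<in> Hcurl \<Omega>" "ae_eq \<Omega> u u'"
  shows "TrT_ext \<Omega> TrT u = TrT_ext \<Omega> TrT u'"
proof
  fix f
  have "stokes_form \<Omega> u w = stokes_form \<Omega> u' w" if "w \<in> Kperp \<Omega> TrT" for w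
    by (rule stokes_form_cong_AE[OF open_\<Omega> assms(1,2) _ _ assms(3)])
       (use that in \<open>auto simp: ae_eq_def intro: H1v_Hcurl Kperp_H1v\<close>)
  then show "TrT_ext \<Omega> TrT u f = TrT_ext \<Omega> TrT u' f"
    using lift_T(1) by (simp add: TrT_ext_def)
qed

end

theorem theorem5p7:
  fixes \<Omega> :: "R3 set" and TrT :: "(R3 \<Rightarrow> R3) \<Rightarrow> bdry_functional"
  assumes "open \<Omega>" and "connected \<Omega>" and "bounded \<Omega>"
    and "H1_extension_property \<Omega>"
    and "is_tangential_trace \<Omega> TrT"
  shows
    \<comment> \<open>well-defined: optimal lifts exist and are unique as elements of H1, the value does not
        depend on the representatives of the lift and of u, and it is an element of the dual\<close>
    "(\<forall>f\<in>B_T \<Omega> TrT.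
        (\<exists>w\<in>Kperp \<Omega> TrT. piT \<Omega> TrT w = f) \<and>
        (\<forall>w\<in>Kperp \<Omega> TrT. \<forall>w'\<in>Kperp \<Omega> TrT.
           piT \<Omega> TrT w = f \<and> piT \<Omega> TrT w' = f \<longrightarrow> ae_eq \<Omega> w w')) \<and>
     (\<forall>u\<in>Hcurl \<Omega>. \<forall>f\<in>B_T \<Omega> TrT. \<forall>w\<in>Kperp \<Omega> TrT.
        piT \<Omega> TrT w = f \<longrightarrow> TrT_ext \<Omega> TrT u f = stokes_form \<Omega> u w) \<and>
     (\<forall>u\<in>Hcurl \<Omega>. \<forall>u'\<in>Hcurl \<Omega>. ae_eq \<Omega> u u' \<longrightarrow> TrT_ext \<Omega> TrT u = TrT_ext \<Omega> TrT u') \<and>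
     (\<forall>u\<in>Hcurl \<Omega>. TrT_ext \<Omega> TrT u \<in> dual (B_T \<Omega> TrT) (B_T_norm \<Omega> TrT)) \<and>
     \<comment> \<open>linear\<close>
     (\<forall>u\<in>Hcurl \<Omega>. \<forall>v\<in>Hcurl \<Omega>. \<forall>a c.
        TrT_ext \<Omega> TrT (\<lambda>x. a *\<^sub>R u x + c *\<^sub>R v x)
          = (\<lambda>f. a * TrT_ext \<Omega> TrT u f + c * TrT_ext \<Omega> TrT v f)) \<and>
     \<comment> \<open>continuous\<close>
     (\<forall>u\<in>Hcurl \<Omega>.
        dual_norm (B_T \<Omega> TrT) (B_T_norm \<Omega> TrT) (TrT_ext \<Omega> TrT u) \<le> sqrt 2 * Hcurl_norm \<Omega> u) \<and>
     \<comment> \<open>Green formula\<close>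
     H1v \<Omega> \<subseteq> Hcurl \<Omega> \<and>
     (\<forall>u\<in>H1v \<Omega>. \<forall>v\<in>H1v \<Omega>.
        stokes_form \<Omega> u v = TrT_ext \<Omega> TrT u (piT \<Omega> TrT v))"
proof -
  interpret tangential_trace \<Omega> TrT
    using assms by unfold_locales
  have "\<Omega> \<in> sets lebesgue" using assms(1) by simp
  note sub = H1v_subset_Hcurl[OF this]
  show ?thesis
  proof (intro conjI ballI allI impI)
    fix f assume "f \<in> B_T \<Omega> TrT"
    then show "\<exists>w\<in>Kperp \<Omega> TrT. piT \<Omega> TrT w = f" using lift_T by blast
  next
    fix f w w' assume "w \<in> Kperp \<Omega> TrT" "w' \<in> Kperp \<Omega> TrT" "piT \<Omega> TrT w = f \<and> piT \<Omega> TrT w' = f"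
    then show "ae_eq \<Omega> w w'" by (intro lift_unique) auto
  next
    fix u f w assume "u \<in> Hcurl \<Omega>" "w \<in> Kperp \<Omega> TrT" "piT \<Omega> TrT w = f"
    then show "TrT_ext \<Omega> TrT u f = stokes_form \<Omega> u w" using TrT_ext_eq by blast
  next
    show "H1v \<Omega> \<subseteq> Hcurl \<Omega>" by (rule sub)
  qed (simp_all add: TrT_ext_cong_AE TrT_ext_dual TrT_ext_lincomb TrT_ext_dual_norm TrT_ext_piT)
qed

end
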